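(* Let $F=F(x,y,z,w)$ be any one of the following sixteen polynomials: (1) $x^6+xy^3+z^2+w^{18}$; (2) $x^5y+xy^3+z^2+w^{14}$; (3) $x^4z+xy^3+z^2+w^{12}$; (4) $x^6+y^2z+z^2+w^{12}$; (5) $x^5y+y^2z+z^2+w^{10}$; (6) $x^3y+y^2z+z^3+w^9$; (7) $x^5+y^3+xz^2+zw^9$; (8) $x^7+xy^3+z^2+yw^{10}$; (9) $x^{11}+y^3+z^2+xw^{12}$; (10) $x^4y+y^3+xz^2+zw^7$; (11) $x^9y+y^3+z^2+xw^{10}$; (12) $x^5z+xy^3+z^2+yw^7$; (13) $x^8z+y^3+z^2+xw^9$; (14) $x^7+y^2z+z^2+xw^8$; (15) $x^6y+y^2z+z^2+xw^7$; (16) $x^5+y^2z+yz^2+xw^6$. Let $f(x,y,z)=F(x,y,z,0)$, let $G$ be the unique lift of $G_{\max}(f)$ to a subgroup of $G_{\max}(F)\cap \mathrm{SL}_4(\mathbb{C})$, and let $(\check F,\check G)$ be the Berglund--Hübsch transpose of the pair $(F,G)$. Let $M$ and $\check M$ be the lattices, and $\Delta_{(F,G)}\subset M_{\mathbb{R}}$ and $\Delta_{(\check F,\check G)}\subset \check M_{\mathbb{R}}$ the Newton polytopes, associated with $(F,G)$ and $(\check F,\check G)$ respectively, and let $N=\mathrm{Hom}(M,\mathbb{Z})$. Then there exist an isomorphism $\varphi:N\to\check M$ of abelian groups and a reflexive polytope $\Delta\subset M_{\mathbb{R}}$ such that $$\Delta_{(F,G)}\subset\Delta\quad\text{and}\quad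 \Delta_{(\check F,\check G)}\subset\varphi(\Delta^\circ),$$ where $\Delta^\circ\subset N_{\mathbb{R}}$ is the polar dual of $\Delta$ and $\varphi$ also denotes its $\mathbb{R}$-linear extension $N_{\mathbb{R}}\to\check M_{\mathbb{R}}$.
   Context: Invertible polynomials. For an $n\times n$ matrix $A=(a_{ij})$ of non-negative integers, the polynomial $\sum_{i=1}^n x_1^{a_{i1}}\cdots x_n^{a_{in}}$ is called invertible if it has an isolated critical point at the origin. Its Berglund--Hübsch transpose is $\sum_{i=1}^n x_1^{a_{1i}}\cdots x_n^{a_{ni}}$, i.e. the polynomial associated with $A^T$. Each $F$ listed is an invertible polynomial in four variables $(x_1,x_2,x_3,x_4)=(x,y,z,w)$ with a matrix $A$, and $\check F$ denotes its transpose. Likewise $f(x,y,z)=F(x,y,z,0)$ is an invertible polynomial in three variables. Weights. $(q_1,\dots,q_4;h)$ denotes the primitive positive integer weight system for which $F$ is weighted homogeneous of degree $h$; $(\check q_1,\dots,\check q_4;\check h)$ is that of $\check F$. Put $J(F)=\mathrm{diag}(e^{2\pi i q_1/h},\dots,e^{2\pi i q_4/h})$, and similarly $J(\check F)$. In all listed cases $q_1+\dots+q_4=h$ and $\check q_1+\dots+\check q_4=\check h$. Groups. For an invertible polynomial $g$ in $n$ variables, $G_{\max}(g)$ is the finite group of diagonal matrices $\mathrm{diag}(\alpha_1,\dots,\alpha_n)\in\mathrm{GL}_n(\mathbb{C})$ with $g(\alpha_1x_1,\dots,\alpha_nx_n)=g(x_1,\dots,x_n)$. The lift $G$ of $G_{\max}(f)$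 is $G=\{\mathrm{diag}(\alpha,\beta,\gamma,(\alpha\beta\gamma)^{-1}) : \mathrm{diag}(\alpha,\beta,\gamma)\in G_{\max}(f)\}$, which is contained in $G_{\max}(F)\cap\mathrm{SL}_4(\mathbb{C})$ and contains $J(F)$. Transpose group. Identifying $(\theta_1,\dots,\theta_4)\in(\mathbb{Q}/\mathbb{Z})^4$ with $\mathrm{diag}(e^{2\pi i\theta_1},\dots,e^{2\pi i\theta_4})$, the group $G_{\max}(F)$ is generated by the columns $\rho_1,\dots,\rho_4$ of $A^{-1}$, and $G_{\max}(\check F)$ by the columns $\check\rho_1,\dots,\check\rho_4$ of $(A^T)^{-1}$. Then $$\check G=\Big\{\check\rho_1^{r_1}\cdots\check\rho_4^{r_4}\in G_{\max}(\check F) : (r_1\ r_2\ r_3\ r_4)\,A^{-1}(a_1\ a_2\ a_3\ a_4)^T\in\mathbb{Z}\ \text{for all}\ \rho_1^{a_1}\cdots\rho_4^{a_4}\in G\Big\}.$$ It contains $J(\check F)$ and is contained in $\mathrm{SL}_4(\mathbb{C})$. Lattices. Let $K\subset(\mathbb{C}^\times)^4$ be the subgroup generated by $G$ and $\{(\alpha^{q_1},\dots,\alpha^{q_4}):\alpha\in\mathbb{C}^\times\}$. $M$ is the character group of the torus $(\mathbb{C}^\times)^4/K$, i.e. $M=\{m\in\mathbb{Z}^4 : t^m=1\text{ for all }t\in K\}$, a free abelian group of rank 3. (This torus is the dense torus of the toric stack $[\mathbb{P}(q_1,\dots,q_4)/(G/\langle J(F)\rangle)]$.) The lattice $\check M$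 is defined in the same way from $(\check F,\check G)$. Write $M_{\mathbb{R}}=M\otimes_{\mathbb{Z}}\mathbb{R}$, etc. Newton polytopes. $\Delta_{(F,G)}\subset M_{\mathbb{R}}$ is the convex hull of the four points $(a_{i1}-1,a_{i2}-1,a_{i3}-1,a_{i4}-1)\in M$, $i=1,\dots,4$ (the exponents of the Laurent monomials of $F/(xyzw)$). $\Delta_{(\check F,\check G)}\subset\check M_{\mathbb{R}}$ is defined in the same way from $\check F/(xyzw)$. Polar duality. For a polytope $\Delta\subset M_{\mathbb{R}}$, $\Delta^\circ=\{n\in N_{\mathbb{R}} : \langle n,m\rangle\ge-1\text{ for all }m\in\Delta\}$. A lattice polytope (convex hull of finitely many points of $M$) is reflexive if $\Delta^\circ$ is a lattice polytope with respect to $N$ (in particular bounded). *)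

theory Defs
  imports
    "HOL-Analysis.Analysis"
    "HOL-Library.Function_Algebras"
    "HOL-Algebra.Elementary_Groups"
begin

text \<open>
  Real-valued functions form a real vector space under the pointwise operations. This provides
  \<open>convex hull\<close> and \<open>linear\<close> for dual spaces, whose elements are functions.
\<close>

instantiation "fun" :: (type, real_vector) real_vector
begin

definition scaleR_fun :: "real \<Rightarrow> ('a \<Rightarrow> 'b) \<Rightarrow> 'a \<Rightarrow> 'b" where
  "scaleR_fun c f = (\<lambda>x. c *\<^sub>R f x)"

instance
  by standard (simp_all add: scaleR_fun_def plus_fun_def fun_eq_iff scaleR_add_right scaleR_add_left)

end


section \<open>Polynomials, weights and diagonal symmetries\<close>

text \<open>
  Row \<open>i\<close> of the matrix is the exponent vector of the \<open>i\<close>-th monomial. Polynomials are represented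
  by the functions they induce on complex space, which loses nothing over an infinite field.
\<close>

definition matrix_poly :: "nat ^ 'n ^ 'n \<Rightarrow> complex ^ 'n \<Rightarrow> complex" where
  "matrix_poly A x = (\<Sum>i\<in>UNIV. \<Prod>j\<in>UNIV. x $ j ^ (A $ i $ j))"

definition weight_system :: "(complex ^ 'n \<Rightarrow> complex) \<Rightarrow> nat ^ 'n \<Rightarrow> nat \<Rightarrow> bool" where
  "weight_system F q h \<longleftrightarrow>
     (\<forall>j. 0 < q $ j) \<and> 0 < h \<and> Gcd (insert h (range (\<lambda>j. q $ j))) = 1 \<and>
     (\<forall>t x. F (\<chi> j. t ^ (q $ j) * x $ j) = t ^ h * F x)"

text \<open>
  A diagonal matrix is represented by the vector of its diagonal entries; the product of matrices
  is then the componentwise product of vectors.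
\<close>

definition torus :: "(complex ^ 'n) monoid" where
  "torus = \<lparr>carrier = {t. \<forall>j. t $ j \<noteq> 0}, monoid.mult = (*), one = 1\<rparr>"

definition G_max :: "(complex ^ 'n \<Rightarrow> complex) \<Rightarrow> (complex ^ 'n) set" where
  "G_max g = {\<alpha> \<in> carrier torus. \<forall>x. g (\<alpha> * x) = g x}"

definition SL4_lift :: "(complex ^ 3) set \<Rightarrow> (complex ^ 4) set" where
  "SL4_lift H = {vector [\<alpha>, \<beta>, \<gamma>, inverse (\<alpha> * \<beta> * \<gamma>)] | \<alpha> \<beta> \<gamma>. vector [\<alpha>, \<beta>, \<gamma>] \<in> H}"


section \<open>The transpose group\<close>

definition real_vec :: "int ^ 'n \<Rightarrow> real ^ 'n" where
  "real_vec m = (\<chi> j. real_of_int (m $ j))"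

definition inv_matrix :: "nat ^ 'n ^ 'n \<Rightarrow> real ^ 'n ^ 'n" where
  "inv_matrix A = matrix_inv (\<chi> i j. real (A $ i $ j))"

definition rho :: "nat ^ 'n ^ 'n \<Rightarrow> 'n \<Rightarrow> complex ^ 'n" where
  "rho A j = (\<chi> k. exp (2 * complex_of_real pi * \<i> * complex_of_real (inv_matrix A $ k $ j)))"

definition rho_word :: "nat ^ 'n ^ 'n \<Rightarrow> int ^ 'n \<Rightarrow> complex ^ 'n" where
  "rho_word A a = (\<chi> k. \<Prod>j\<in>UNIV. (rho A j $ k) powi (a $ j))"

definition transpose_group :: "nat ^ 'n ^ 'n \<Rightarrow> (complex ^ 'n) set \<Rightarrow> (complex ^ 'n) set" where
  "transpose_group A G =
     {rho_word (transpose A) r | r.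
        rho_word (transpose A) r \<in> G_max (matrix_poly (transpose A)) \<and>
        (\<forall>a. rho_word A a \<in> G \<longrightarrow> real_vec r \<bullet> (inv_matrix A *v real_vec a) \<in> \<int>)}"


section \<open>Lattices\<close>

definition character_lattice :: "nat ^ 'n \<Rightarrow> (complex ^ 'n) set \<Rightarrow> (int ^ 'n) set" where
  "character_lattice q G =
     {m. \<forall>t \<in> generate torus (G \<union> {\<chi> j. \<alpha> ^ (q $ j) | \<alpha>. \<alpha> \<noteq> 0}).
           (\<Prod>j\<in>UNIV. (t $ j) powi (m $ j)) = 1}"

definition additive_group :: "'a::ab_group_add set \<Rightarrow> 'a monoid" where
  "additive_group L = \<lparr>carrier = L, monoid.mult = (+), one = 0\<rparr>"

text \<open>
  \<open>M \<otimes> \<real>\<close> is realised as the real span of \<open>M\<close>, since \<open>M\<close> consists of integer vectors.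
  Homomorphisms on \<open>M\<close>, and linear functionals on \<open>M \<otimes> \<real>\<close>, are represented by
  functions that vanish outside their domain; the representation is then unique and the pointwise
  operations are the right ones.
\<close>

definition real_space :: "(int ^ 'n) set \<Rightarrow> (real ^ 'n) set" where
  "real_space M = span (real_vec ` M)"

definition dual_lattice :: "(int ^ 'n) set \<Rightarrow> (int ^ 'n \<Rightarrow> int) set" where
  "dual_lattice M = {n \<in> hom (additive_group M) integer_group. \<forall>m. m \<notin> M \<longrightarrow> n m = 0}"

definition dual_space :: "(int ^ 'n) set \<Rightarrow> (real ^ 'n \<Rightarrow> real) set" where
  "dual_space M =
     {\<nu>. (\<forall>x \<in> real_space M. \<forall>y \<in> real_space M. \<nu> (x + y) = \<nu> x + \<nu> y) \<and>
         (\<forall>c. \<forall>x \<in> real_space M. \<nu> (c *\<^sub>R x) = c * \<nu> x) \<and>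
         (\<forall>x. x \<notin> real_space M \<longrightarrow> \<nu> x = 0)}"

text \<open>
  The canonical embedding of \<open>N = Hom(M, \<int>)\<close> into \<open>N \<otimes> \<real> = Hom(M \<otimes> \<real>, \<real>)\<close>, as the unique linear
  extension of a homomorphism. Its image spans \<open>dual_space M\<close>, so a linear map that is
  prescribed on \<open>real_ext M ` dual_lattice M\<close> is determined on \<open>dual_space M\<close>.
\<close>

definition real_ext :: "(int ^ 'n) set \<Rightarrow> (int ^ 'n \<Rightarrow> int) \<Rightarrow> real ^ 'n \<Rightarrow> real" where
  "real_ext M n = (THE \<nu>. \<nu> \<in> dual_space M \<and> (\<forall>m \<in> M. \<nu> (real_vec m) = real_of_int (n m)))"


section \<open>Polytopes\<close>

definition newton_polytope :: "nat ^ 'n ^ 'n \<Rightarrow> (real ^ 'n) set" where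
  "newton_polytope A = convex hull (range (\<lambda>i. real_vec (\<chi> j. int (A $ i $ j) - 1)))"

definition polar_dual :: "(int ^ 'n) set \<Rightarrow> (real ^ 'n) set \<Rightarrow> (real ^ 'n \<Rightarrow> real) set" where
  "polar_dual M \<Delta> = {\<nu> \<in> dual_space M. \<forall>x \<in> \<Delta>. \<nu> x \<ge> -1}"

definition lattice_polytope :: "'v::real_vector set \<Rightarrow> 'v set \<Rightarrow> bool" where
  "lattice_polytope L P \<longleftrightarrow> (\<exists>S. finite S \<and> S \<subseteq> L \<and> P = convex hull S)"

definition reflexive_polytope :: "(int ^ 'n) set \<Rightarrow> (real ^ 'n) set \<Rightarrow> bool" where
  "reflexive_polytope M \<Delta> \<longleftrightarrow>
     lattice_polytope (real_vec ` M) \<Delta> \<and>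
     lattice_polytope (real_ext M ` dual_lattice M) (polar_dual M \<Delta>)"


section \<open>The sixteen polynomials\<close>

definition sixteen_matrices :: "(nat ^ 4 ^ 4) list" where
  "sixteen_matrices = map (\<lambda>rows. vector (map vector rows))
    [[[6,0,0,0], [1,3,0,0], [0,0,2,0], [0,0,0,18]],
     [[5,1,0,0], [1,3,0,0], [0,0,2,0], [0,0,0,14]],
     [[4,0,1,0], [1,3,0,0], [0,0,2,0], [0,0,0,12]],
     [[6,0,0,0], [0,2,1,0], [0,0,2,0], [0,0,0,12]],
     [[5,1,0,0], [0,2,1,0], [0,0,2,0], [0,0,0,10]],
     [[3,1,0,0], [0,2,1,0], [0,0,3,0], [0,0,0,9]],
     [[5,0,0,0], [0,3,0,0], [1,0,2,0], [0,0,1,9]],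
     [[7,0,0,0], [1,3,0,0], [0,0,2,0], [0,1,0,10]],
     [[11,0,0,0], [0,3,0,0], [0,0,2,0], [1,0,0,12]],
     [[4,1,0,0], [0,3,0,0], [1,0,2,0], [0,0,1,7]],
     [[9,1,0,0], [0,3,0,0], [0,0,2,0], [1,0,0,10]],
     [[5,0,1,0], [1,3,0,0], [0,0,2,0], [0,1,0,7]],
     [[8,0,1,0], [0,3,0,0], [0,0,2,0], [1,0,0,9]],
     [[7,0,0,0], [0,2,1,0], [0,0,2,0], [1,0,0,8]],
     [[6,1,0,0], [0,2,1,0], [0,0,2,0], [1,0,0,7]],
     [[5,0,0,0], [0,2,1,0], [0,1,2,0], [1,0,0,6]]]"

lemma vector_4 [simp]:
  "(vector [x, y, z, w] :: ('a::zero) ^ 4) $ 1 = x"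
  "(vector [x, y, z, w] :: ('a::zero) ^ 4) $ 2 = y"
  "(vector [x, y, z, w] :: ('a::zero) ^ 4) $ 3 = z"
  "(vector [x, y, z, w] :: ('a::zero) ^ 4) $ 4 = w"
  unfolding vector_def by simp_all

lemma prod_4: "prod f (UNIV :: 4 set) = f 1 * f 2 * f 3 * f 4"
  unfolding UNIV_4 by (simp add: ac_simps)

lemma matrix_poly_4:
  fixes A :: "nat ^ 4 ^ 4"
  shows "matrix_poly A (vector [x, y, z, w]) =
     x ^ (A $ 1 $ 1) * y ^ (A $ 1 $ 2) * z ^ (A $ 1 $ 3) * w ^ (A $ 1 $ 4) +
     x ^ (A $ 2 $ 1) * y ^ (A $ 2 $ 2) * z ^ (A $ 2 $ 3) * w ^ (A $ 2 $ 4) +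
     x ^ (A $ 3 $ 1) * y ^ (A $ 3 $ 2) * z ^ (A $ 3 $ 3) * w ^ (A $ 3 $ 4) +
     x ^ (A $ 4 $ 1) * y ^ (A $ 4 $ 2) * z ^ (A $ 4 $ 3) * w ^ (A $ 4 $ 4)"
  by (simp only: matrix_poly_def sum_4 prod_4 vector_4)

lemma sixteen_polynomials:
  "map (\<lambda>A x y z w. matrix_poly A (vector [x, y, z, w])) sixteen_matrices =
    [\<lambda>x y z w. x^6 + x*y^3 + z^2 + w^18,
     \<lambda>x y z w. x^5*y + x*y^3 + z^2 + w^14,
     \<lambda>x y z w. x^4*z + x*y^3 + z^2 + w^12,
     \<lambda>x y z w. x^6 + y^2*z + z^2 + w^12,
     \<lambda>x y z w. x^5*y + y^2*z + z^2 + w^10,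
     \<lambda>x y z w. x^3*y + y^2*z + z^3 + w^9,
     \<lambda>x y z w. x^5 + y^3 + x*z^2 + z*w^9,
     \<lambda>x y z w. x^7 + x*y^3 + z^2 + y*w^10,
     \<lambda>x y z w. x^11 + y^3 + z^2 + x*w^12,
     \<lambda>x y z w. x^4*y + y^3 + x*z^2 + z*w^7,
     \<lambda>x y z w. x^9*y + y^3 + z^2 + x*w^10,
     \<lambda>x y z w. x^5*z + x*y^3 + z^2 + y*w^7,
     \<lambda>x y z w. x^8*z + y^3 + z^2 + x*w^9,
     \<lambda>x y z w. x^7 + y^2*z + z^2 + x*w^8,
     \<lambda>x y z w. x^6*y + y^2*z + z^2 + x*w^7,
     \<lambda>x y z w. x^5 + y^2*z + y*z^2 + x*w^6]"
  by (simp only: sixteen_matrices_def list.map matrix_poly_4 vector_4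
      power_0 power_one_right mult_1_left mult_1_right)

end

(*
  Let k be the weight system of the transpose of F. In all sixteen cases k_4 = 1, and the degree is
  the exponent a_44. Let e_1, ..., e_4 be the exponents of the monomials of F/(xyzw). Then
  k_1 e_1 + ... + k_4 e_4 = 0. Since G consists of the elements exp(2 pi i A^(-1) a) with k.a = 0,
  the lattice M is spanned by the e_i, and the transposed lattice is the full hyperplane k.m = 0 in
  Z^4. Hence n |-> (n(e_1), ..., n(e_4)) is the isomorphism from N, with inverse
  m |-> (x |-> x . A^(-1) m). It remains to find a reflexive polytope spanned by the e_i and at most
  two further lattice points, whose polar contains the exponents of the transposed polynomial.
  The vertices of the polar are certified by barycentric coordinates on a triangulation.
*)

theory Submission
  imports Defs
begin

text \<open>The normalisation of k comes from the fourth column of A: w occurs only in the fourth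
  monomial of F, so that column of the transposed weight equations says that the degree is a_44 k_4,
  and primitivity forces k_4 = 1. The weights q of F are never computed; only A q = (h,...,h)
  enters. In the coordinates n(e_i) the polar of the hull of the e_i is the simplex k.y = 0, y_i >=
  -1. As k_1 + ... + k_4 = a_44, its vertex opposite to the facet y_i = -1 has y_i = a_44/k_i - 1,
  which is integral exactly when k_i divides a_44. For five of the weight systems this holds for
  every i. For the others, further lattice points must cut off the non-integral vertices. The cut
  c.y >= -1 keeps the exponents of the transposed polynomial exactly when all entries of the point
  c_1 e_1 + ... + c_4 e_4 are at least -1, that is, when this point is the exponent vector of a
  monomial of degree h divided by xyzw. The extra points therefore come from monomials of the same
  weighted degree as F.\<close>

lemma real_vec_nth [simp]: "real_vec m $ j = of_int (m $ j)"
  by (simp add: real_vec_def)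

lemma real_vec_eq_iff [simp]: "real_vec a = real_vec b \<longleftrightarrow> a = b"
  by (simp add: vec_eq_iff)

lemma prod_power_int:
  fixes f :: "'b \<Rightarrow> 'a :: field"
  shows "prod f S powi n = (\<Prod>i\<in>S. f i powi n)"
  by (induction S rule: infinite_finite_induct) (auto simp: power_int_mult_distrib)

lemma power_int_sum:
  fixes x :: "'a :: field"
  assumes "x \<noteq> 0"
  shows "x powi (\<Sum>i\<in>S. f i) = (\<Prod>i\<in>S. x powi f i)"
  by (induction S rule: infinite_finite_induct) (auto simp: power_int_add assms)

section \<open>Monomials and characters on the diagonal torus\<close>

definition unit_exp :: "real ^ 'n \<Rightarrow> complex ^ 'n" where
  "unit_exp \<theta> = (\<chi> j. exp (2 * complex_of_real pi * \<i> * complex_of_real (\<theta> $ j)))"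

definition monomial :: "nat ^ 'n \<Rightarrow> complex ^ 'n \<Rightarrow> complex" where
  "monomial a x = (\<Prod>j\<in>UNIV. x $ j ^ (a $ j))"

definition character :: "int ^ 'n \<Rightarrow> complex ^ 'n \<Rightarrow> complex" where
  "character m t = (\<Prod>j\<in>UNIV. t $ j powi (m $ j))"

definition real_mat :: "nat ^ 'n ^ 'm \<Rightarrow> real ^ 'n ^ 'm" where
  "real_mat A = (\<chi> i j. real (A $ i $ j))"

lemma real_mat_nth [simp]: "real_mat A $ i $ j = real (A $ i $ j)"
  by (simp add: real_mat_def)

lemma real_mat_transpose: "real_mat (transpose A) = transpose (real_mat A)"
  by (simp add: vec_eq_iff transpose_def)

lemma matrix_poly_monomial: "matrix_poly A x = (\<Sum>i\<in>UNIV. monomial (A $ i) x)"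
  by (simp add: matrix_poly_def monomial_def)

lemma monomial_mult: "monomial a (x * y) = monomial a x * monomial a y"
  by (simp add: monomial_def power_mult_distrib prod.distrib)

lemma monomial_eq_character: "monomial a x = character (\<chi> j. int (a $ j)) x"
  by (simp add: monomial_def character_def)

lemma exp_2pi_eq_1_iff:
  "exp (2 * complex_of_real pi * \<i> * complex_of_real x) = 1 \<longleftrightarrow> x \<in> \<int>"
  by (auto simp: exp_eq_1 Ints_def)

lemma character_unit_exp:
  "character m (unit_exp \<theta>) = exp (2 * complex_of_real pi * \<i> * complex_of_real (real_vec m \<bullet> \<theta>))"
  by (simp add: character_def unit_exp_def inner_vec_def sum_distrib_left exp_sum exp_power_int mult_ac)

lemma character_unit_exp_eq_1_iff: "character m (unit_exp \<theta>) = 1 \<longleftrightarrow> real_vec m \<bullet> \<theta> \<in> \<int>"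
  by (simp add: character_unit_exp exp_2pi_eq_1_iff)

lemma unit_exp_torus: "unit_exp \<theta> \<in> carrier torus"
  by (simp add: torus_def unit_exp_def)

lemma rho_word_unit_exp: "rho_word A a = unit_exp (inv_matrix A *v real_vec a)"
  by (simp add: vec_eq_iff rho_word_def rho_def unit_exp_def matrix_vector_mult_def
        sum_distrib_left exp_sum exp_power_int mult_ac)

lemma character_one [simp]: "character m 1 = 1"
  by (simp add: character_def)

lemma character_mult: "character m (s * t) = character m s * character m t"
  by (simp add: character_def power_int_mult_distrib prod.distrib)

lemma group_torus: "group torus"
proof (rule groupI)
  fix t :: "complex ^ 'n"
  assume "t \<in> carrier torus"
  then have "(\<chi> j. inverse (t $ j)) \<in> carrier torus \<and> (\<chi> j. inverse (t $ j)) \<otimes>\<^bsub>torus\<^esub> t = \<one>\<^bsub>torus\<^esub>"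
    by (simp add: torus_def vec_eq_iff)
  then show "\<exists>s\<in>carrier torus. s \<otimes>\<^bsub>torus\<^esub> t = \<one>\<^bsub>torus\<^esub>"
    by blast
qed (auto simp: torus_def mult.assoc)

text \<open>Characters are homomorphisms, so triviality can be tested on generators; on the
  one-parameter subgroup with exponents \<open>q\<close> the character \<open>m\<close> is \<alpha>
  raised to the pairing of \<open>q\<close> and \<open>m\<close>.\<close>

lemma character_lattice_iff:
  assumes "G \<subseteq> carrier torus"
  shows "m \<in> character_lattice q G \<longleftrightarrow>
    (\<forall>t\<in>G. character m t = 1) \<and> (\<Sum>j\<in>UNIV. int (q $ j) * m $ j) = 0"
proof -
  let ?C = "{\<chi> j. \<alpha> ^ (q $ j) | \<alpha>. \<alpha> \<noteq> (0::complex)}"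
  have C: "?C \<subseteq> carrier torus"
    by (auto simp: torus_def)
  interpret group "torus :: (complex ^ 'n) monoid"
    by (rule group_torus)
  have char_C: "character m (\<chi> j. \<alpha> ^ (q $ j)) = \<alpha> powi (\<Sum>j\<in>UNIV. int (q $ j) * m $ j)"
    if "\<alpha> \<noteq> 0" for \<alpha>
    using that by (simp add: character_def power_int_sum power_int_mult)
  have gen: "character m t = 1"
    if "t \<in> generate torus (G \<union> ?C)" and G: "\<forall>t\<in>G. character m t = 1"
      and q: "(\<Sum>j\<in>UNIV. int (q $ j) * m $ j) = 0" for t
    using that(1)
  proof (induction rule: generate.induct)
    case one
    then show ?case by (simp add: torus_def)
  next
    case (incl h)
    then show ?case using G char_C q by auto
  next
    case (inv h)
    then have h: "h \<in> carrier torus" "character m h = 1"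
      using assms C G char_C q by auto
    have "character m (inv\<^bsub>torus\<^esub> h \<otimes>\<^bsub>torus\<^esub> h) = 1"
      by (simp only: l_inv[OF h(1)]) (simp add: torus_def)
    then show ?case
      using h(2) by (simp add: torus_def character_mult)
  next
    case (eng h1 h2)
    then show ?case by (simp add: torus_def character_mult)
  qed
  show ?thesis
  proof (intro iffI conjI ballI)
    assume m: "m \<in> character_lattice q G"
    then show "character m t = 1" if "t \<in> G" for t
      using that unfolding character_lattice_def character_def by (blast intro: generate.incl)
    \<comment> \<open>The parameter value 2 suffices: no nonzero power of 2 has norm 1, so the
      pairing of \<open>q\<close> and \<open>m\<close> vanishes.\<close>
    have "character m (\<chi> j. 2 ^ (q $ j)) = 1"
    proof -
      have "(\<chi> j. 2 ^ (q $ j)) \<in> generate torus (G \<union> ?C)"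
        by (rule generate.incl) (auto intro!: exI[of _ 2])
      then show ?thesis
        using m unfolding character_lattice_def character_def by blast
    qed
    then have "(2::complex) powi (\<Sum>j\<in>UNIV. int (q $ j) * m $ j) = 1"
      by (simp add: char_C)
    then have "norm ((2::complex) powi (\<Sum>j\<in>UNIV. int (q $ j) * m $ j)) = 1"
      by simp
    then have "(2::real) powi (\<Sum>j\<in>UNIV. int (q $ j) * m $ j) = 1"
      by (simp add: norm_power_int)
    moreover have "n = 0" if "(2::real) ^ n = 1" for n
      using that power_inject_exp[of "2::real" n 0] by simp
    ultimately show "(\<Sum>j\<in>UNIV. int (q $ j) * m $ j) = 0"
      by (cases "\<Sum>j\<in>UNIV. int (q $ j) * m $ j" rule: int_cases2) (auto simp: power_int_minus)
  next
    assume "(\<forall>t\<in>G. character m t = 1) \<and> (\<Sum>j\<in>UNIV. int (q $ j) * m $ j) = 0"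
    then show "m \<in> character_lattice q G"
      using gen unfolding character_lattice_def character_def by blast
  qed
qed

section \<open>Independence of the monomials and the weight equations\<close>

text \<open>Logarithms turn the monomial equations into the linear system with matrix
  \<open>A\<close>. A real inverse \<open>B\<close> solves it, because real exponents are harmless
  inside \<open>exp\<close>.\<close>

lemma exists_monomials:
  fixes A :: "nat ^ 'n ^ 'n"
    and y :: "complex ^ 'n"
  assumes inv: "invertible (real_mat A)" and y: "\<And>i. y $ i \<noteq> 0"
  shows "\<exists>x. \<forall>i. monomial (A $ i) x = y $ i"
proof -
  obtain B where B: "real_mat A ** B = mat 1"
    using inv by (auto simp: invertible_def)
  have AB: "(\<Sum>j\<in>UNIV. of_nat (A $ i $ j) * complex_of_real (B $ j $ l)) = (if i = l then 1 else 0)"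
    for i l
  proof -
    have "(real_mat A ** B) $ i $ l = (if i = l then 1 else 0)"
      by (simp add: B mat_def)
    then have "complex_of_real (\<Sum>j\<in>UNIV. real (A $ i $ j) * B $ j $ l) = (if i = l then 1 else 0)"
      by (simp add: matrix_matrix_mult_def)
    then show ?thesis
      by simp
  qed
  define x where "x = (\<chi> j. exp (\<Sum>l\<in>UNIV. complex_of_real (B $ j $ l) * Ln (y $ l)))"
  have "monomial (A $ i) x = y $ i" for i
  proof -
    have "monomial (A $ i) x =
        exp (\<Sum>j\<in>UNIV. of_nat (A $ i $ j) * (\<Sum>l\<in>UNIV. complex_of_real (B $ j $ l) * Ln (y $ l)))"
      by (simp add: monomial_def x_def exp_sum exp_of_nat_mult)
    also have "(\<Sum>j\<in>UNIV. of_nat (A $ i $ j) * (\<Sum>l\<in>UNIV. complex_of_real (B $ j $ l) * Ln (y $ l))) =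
        (\<Sum>l\<in>UNIV. (\<Sum>j\<in>UNIV. of_nat (A $ i $ j) * complex_of_real (B $ j $ l)) * Ln (y $ l))"
      by (simp add: sum_distrib_left sum_distrib_right mult.assoc) (rule sum.swap)
    also have "\<dots> = (\<Sum>l\<in>UNIV. if i = l then Ln (y $ l) else 0)"
      by (simp add: AB if_distrib[of "\<lambda>u. u * _"] cong: if_cong)
    finally show ?thesis
      using y by simp
  qed
  then show ?thesis
    by blast
qed

text \<open>Symmetry and homogeneity are stated for polynomial functions; this extracts from them
  equations for single monomials. Since the monomials attain arbitrary nonzero values
  simultaneously, the relation is a linear form that vanishes on the whole torus.\<close>

lemma monomials_independent:
  fixes A :: "nat ^ 'n ^ 'n"
  assumes inv: "invertible (real_mat A)" and c: "\<And>x. (\<Sum>i\<in>UNIV. c i * monomial (A $ i) x) = 0"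
  shows "c i = 0"
proof -
  have y: "(\<Sum>i\<in>UNIV. c i * y $ i) = 0" if nz: "\<And>i. y $ i \<noteq> 0" for y :: "complex ^ 'n"
  proof -
    obtain x where "\<And>i. monomial (A $ i) x = y $ i"
      using exists_monomials[OF inv, of y] nz by blast
    then show ?thesis
      using c[of x] by simp
  qed
  \<comment> \<open>Two points of the torus that differ by 1 in coordinate \<open>i\<close> alone
    are compared; the difference of the two relations is \<open>c i\<close>.\<close>
  have "(\<Sum>l\<in>UNIV. c l * (if l = i then 2 else 1)) = 0"
    using y[of "\<chi> l. if l = i then 2 else 1"] by simp
  moreover have "(\<Sum>l\<in>UNIV. c l) = 0"
    using y[of "\<chi> l. 1"] by simp
  moreover have "(\<Sum>l\<in>UNIV. c l * (if l = i then 2 else 1)) = (\<Sum>l\<in>UNIV. c l + (if l = i then c l else 0))"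
    by (rule sum.cong) auto
  ultimately show ?thesis
    by (simp add: sum.distrib)
qed

text \<open>At t = 2 homogeneity is a relation between the monomials, with coefficients
  \<open>2 ^ ?d i - 2 ^ h\<close>. These vanish by independence, and powers of 2 determine their
  exponents.\<close>

lemma weight_system_matrix_poly:
  assumes inv: "invertible (real_mat A)" and w: "weight_system (matrix_poly A) q h"
  shows "(\<Sum>j\<in>UNIV. A $ i $ j * q $ j) = h"
proof -
  let ?d = "\<lambda>i. \<Sum>j\<in>UNIV. A $ i $ j * q $ j"
  have mono: "monomial (A $ i) (\<chi> j. 2 ^ (q $ j) * x $ j) = 2 ^ ?d i * monomial (A $ i) x" for i x
    by (simp add: monomial_def power_mult_distrib prod.distrib mult.commute flip: power_mult power_sum)
  have "(2::complex) ^ ?d i - 2 ^ h = 0"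
  proof (rule monomials_independent[OF inv, where c = "\<lambda>i. 2 ^ ?d i - 2 ^ h"])
    fix x
    have "matrix_poly A (\<chi> j. 2 ^ (q $ j) * x $ j) = 2 ^ h * matrix_poly A x"
      using w by (simp add: weight_system_def)
    then show "(\<Sum>i\<in>UNIV. ((2::complex) ^ ?d i - 2 ^ h) * monomial (A $ i) x) = 0"
      by (simp add: matrix_poly_monomial mono left_diff_distrib sum_subtractf sum_distrib_left)
  qed
  then have "(of_nat (2 ^ ?d i) :: complex) = of_nat (2 ^ h)"
    by simp
  then have "(2::nat) ^ ?d i = 2 ^ h"
    by (simp only: of_nat_eq_iff)
  then show ?thesis
    by simp
qed

lemma inv_matrix_inverse:
  assumes "invertible (real_mat A)"
  shows "real_mat A ** inv_matrix A = mat 1" and "inv_matrix A ** real_mat A = mat 1"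
  using someI_ex[OF assms[unfolded invertible_def]]
  by (simp_all add: inv_matrix_def matrix_inv_def real_mat_def)

lemma inv_matrix_transpose:
  assumes inv: "invertible (real_mat A)"
  shows "inv_matrix (transpose A) = transpose (inv_matrix A)"
proof -
  have 1: "inv_matrix (transpose A) ** transpose (real_mat A) = mat 1"
    using inv_matrix_inverse(2)[of "transpose A"] inv by (simp add: real_mat_transpose transpose_invertible)
  have 2: "transpose (real_mat A) ** transpose (inv_matrix A) = mat 1"
    by (simp add: inv_matrix_inverse[OF inv] flip: matrix_transpose_mul)
  have "inv_matrix (transpose A) = inv_matrix (transpose A) ** (transpose (real_mat A) ** transpose (inv_matrix A))"
    by (simp only: 2 matrix_mul_rid)
  also have "\<dots> = transpose (inv_matrix A)"
    by (simp only: matrix_mul_assoc 1 matrix_mul_lid)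
  finally show ?thesis .
qed

text \<open>The axis vectors generate the free group of integer vectors. Applied after
  \<open>comb\<close>, this shows that an element of N is determined on M by its values at the four
  vertices.\<close>

lemma additive_int_vec:
  fixes g :: "int ^ 'n \<Rightarrow> int"
  assumes add: "\<And>a b. g (a + b) = g a + g b"
  shows "g a = (\<Sum>i\<in>UNIV. a $ i * g (axis i 1))"
proof -
  have zero: "g 0 = 0"
    using add[of 0 0] by simp
  have minus: "g (- b) = - g b" for b
    using add[of b "- b"] zero by simp
  have nat: "g (axis i (int n)) = int n * g (axis i 1)" for i n
  proof (induction n)
    case 0
    have "axis i (int 0) = 0"
      by (simp add: vec_eq_iff axis_def)
    then show ?case by (simp only: zero)
  next
    case (Suc n)
    have "axis i (int (Suc n)) = axis i (int n) + axis i 1"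
      by (simp add: vec_eq_iff axis_def)
    then show ?case
      using Suc by (simp add: add algebra_simps)
  qed
  have int: "g (axis i c) = c * g (axis i 1)" for i c
  proof (cases c rule: int_cases2)
    case (nonneg n)
    then show ?thesis by (simp add: nat)
  next
    case (nonpos n)
    then have "axis i c = - axis i (int n)"
      by (simp add: vec_eq_iff axis_def)
    then show ?thesis
      using nonpos by (simp add: nat minus)
  qed
  have axes: "(\<Sum>i\<in>UNIV. axis i (a $ i)) = a"
    by (simp add: vec_eq_iff axis_def)
  have "g (\<Sum>i\<in>S. axis i (a $ i)) = (\<Sum>i\<in>S. a $ i * g (axis i 1))" for S
    by (induction S rule: infinite_finite_induct) (simp_all add: zero add int[of _ "a $ _"])
  from this[of UNIV] show ?thesis
    by (simp only: axes)
qed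


text \<open>Points and coefficients are matched by position, so that a certificate can be an
  explicit list and coinciding points do no harm.\<close>

lemma sum_list_in_convex_hull:
  assumes "length us = length ws" and "\<And>u. u \<in> set us \<Longrightarrow> 0 \<le> u" and "sum_list us = 1"
  shows "sum_list (map2 (*\<^sub>R) us ws) \<in> convex hull (set ws)"
proof -
  have "sum_list us = (\<Sum>i<length ws. us ! i)"
    using assms(1) by (simp add: sum_list_sum_nth atLeast0LessThan)
  moreover have "sum_list (map2 (*\<^sub>R) us ws) = (\<Sum>i<length ws. us ! i *\<^sub>R ws ! i)"
    using assms(1) by (simp add: sum_list_sum_nth atLeast0LessThan)
  moreover have "(\<Sum>i<length ws. us ! i *\<^sub>R ws ! i) \<in> convex hull (set ws)"
    using assms calculation by (intro convex_sum) (auto simp: hull_inc)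
  ultimately show ?thesis
    by simp
qed

text \<open>
  The vectors in \<open>X\<close> are coefficients with respect to the Newton vertices of the polynomial, whereas
  those in \<open>W\<close> are elements of the dual lattice, identified with the hyperplane orthogonal to \<open>k\<close>.
  The inequalities \<open>y $ i \<ge> -1\<close> come from the Newton vertices themselves.
\<close>

definition polar_pair :: "int ^ 'n \<Rightarrow> (int ^ 'n) set \<Rightarrow> (int ^ 'n) set \<Rightarrow> bool" where
  "polar_pair k X W \<longleftrightarrow> finite X \<and> finite W \<and>
     {y. real_vec k \<bullet> y = 0 \<and> (\<forall>i. y $ i \<ge> -1) \<and> (\<forall>c\<in>X. real_vec c \<bullet> y \<ge> -1)} =
     convex hull (real_vec ` W)"

section \<open>Coordinates with respect to the vertices of the Newton polytope\<close>

text \<open>By \<open>last_column\<close>, setting w = 0 deletes the fourth monomial and leaves the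
  other three unchanged. \<open>weights\<close> and \<open>weights_sum\<close> say that the
  transposed polynomial and the product xyzw both have degree a_44 for the weights \<open>k\<close>;
  their difference is the linear relation between the vertices.\<close>

locale weighted_matrix =
  fixes A :: "nat ^ 4 ^ 4" and k :: "int ^ 4"
  assumes invertible: "invertible (real_mat A)"
    and last_column: "\<And>i. i \<noteq> 4 \<Longrightarrow> A $ i $ 4 = 0" "A $ 4 $ 4 > 0"
    and weights: "\<And>j. (\<Sum>i\<in>UNIV. k $ i * int (A $ i $ j)) = int (A $ 4 $ 4)"
    and weights_sum: "(\<Sum>i\<in>UNIV. k $ i) = int (A $ 4 $ 4)"
    and last_weight: "k $ 4 = 1"
begin

abbreviation "R \<equiv> real_mat A"
abbreviation "B \<equiv> inv_matrix A"

definition vertex :: "4 \<Rightarrow> int ^ 4" where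
  "vertex i = (\<chi> j. int (A $ i $ j) - 1)"

text \<open>This parametrization of M is redundant, since \<open>k\<close> is mapped to 0, but it is
  symmetric in the four vertices and avoids the choice of a basis of M.\<close>

definition comb :: "int ^ 4 \<Rightarrow> int ^ 4" where
  "comb a = (\<chi> j. \<Sum>i\<in>UNIV. a $ i * vertex i $ j)"

definition real_comb :: "real ^ 4 \<Rightarrow> real ^ 4" where
  "real_comb x = (\<Sum>i\<in>UNIV. x $ i *\<^sub>R real_vec (vertex i))"

lemma R_B: "R *v (B *v y) = y"
  by (simp add: matrix_vector_mul_assoc inv_matrix_inverse[OF invertible])

lemma B_R: "B *v (R *v y) = y"
  by (simp add: matrix_vector_mul_assoc inv_matrix_inverse[OF invertible])

lemma vertex_inner: "real_vec (vertex i) \<bullet> x = (R *v x) $ i - (\<Sum>j\<in>UNIV. x $ j)"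
  by (simp add: vertex_def inner_vec_def matrix_vector_mult_def left_diff_distrib sum_subtractf)

lemma weights_inner: "real_vec k \<bullet> (R *v x) = real (A $ 4 $ 4) * (\<Sum>j\<in>UNIV. x $ j)"
proof -
  have "(\<Sum>i\<in>UNIV. of_int (k $ i) * real (A $ i $ j)) = real (A $ 4 $ 4)" for j
    using arg_cong[OF weights[of j], of real_of_int] by simp
  then have "real_vec k v* R = (\<chi> j. real (A $ 4 $ 4))"
    by (simp add: vec_eq_iff vector_matrix_mult_def mult.commute)
  then show ?thesis
    by (simp flip: dot_lmul_matrix) (simp add: inner_vec_def sum_distrib_left)
qed

text \<open>For \<open>y = real_vec a\<close> the left side is the exponent of the determinant of
  \<open>rho_word A a\<close>, so vectors \<open>a\<close> orthogonal to \<open>k\<close> give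
  determinant 1.\<close>

lemma sum_B: "(\<Sum>j\<in>UNIV. (B *v y) $ j) = (real_vec k \<bullet> y) / real (A $ 4 $ 4)"
  using weights_inner[of "B *v y"] last_column(2) by (simp add: R_B field_simps)

text \<open>A vertex is a row of \<open>A\<close> minus the all-ones vector. The row recovers
  \<open>y $ i\<close>, and the all-ones vector contributes the coordinate sum of
  \<open>B *v y\<close>, which is 0 by \<open>sum_B\<close>.\<close>

lemma vertex_inner_B: "real_vec k \<bullet> y = 0 \<Longrightarrow> real_vec (vertex i) \<bullet> (B *v y) = y $ i"
  by (simp add: vertex_inner R_B sum_B)

lemma real_comb_inner_B: "real_vec k \<bullet> y = 0 \<Longrightarrow> real_comb x \<bullet> (B *v y) = x \<bullet> y"
  by (simp add: real_comb_def inner_sum_left vertex_inner_B) (simp add: inner_vec_def)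

lemma real_comb_real_vec: "real_comb (real_vec a) = real_vec (comb a)"
  by (simp add: vec_eq_iff real_comb_def comb_def)

lemma comb_k: "comb k = 0"
  by (simp add: vec_eq_iff comb_def vertex_def right_diff_distrib sum_subtractf weights weights_sum)

lemma linear_real_comb: "linear real_comb"
  by (intro linearI)
    (simp_all add: real_comb_def scaleR_add_left sum.distrib scaleR_sum_right)

lemma comb_add: "comb (a + b) = comb a + comb b"
  by (simp add: vec_eq_iff comb_def distrib_right sum.distrib)

lemma comb_axis: "comb (axis i 1) = vertex i"
  by (simp add: vec_eq_iff comb_def axis_def if_distrib[of "\<lambda>c. c * _"] cong: if_cong)

text \<open>As \<open>k $ 4 = 1\<close>, subtracting a multiple of \<open>k\<close> removes the
  fourth vertex from any combination. This matters because membership in \<open>G\<close> directly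
  controls only the first three monomials.\<close>

lemma comb_eq_reduced: "comb a = comb (\<chi> i. a $ i - k $ i * a $ 4)"
proof -
  have "(\<chi> i. a $ i - k $ i * a $ 4) = a + (\<chi> i. - (k $ i * a $ 4))"
    by (simp add: vec_eq_iff)
  moreover have "comb (\<chi> i. - (k $ i * a $ 4)) $ j = - (a $ 4) * comb k $ j" for j
    by (simp add: comb_def sum_distrib_left sum_negf mult_ac)
  then have "comb (\<chi> i. - (k $ i * a $ 4)) = 0"
    by (simp add: comb_k vec_eq_iff)
  ultimately show ?thesis
    by (simp add: comb_add)
qed

lemma real_comb_inner: "real_comb y \<bullet> x = y \<bullet> (R *v x) - (\<Sum>i\<in>UNIV. y $ i) * (\<Sum>j\<in>UNIV. x $ j)"
  by (simp add: real_comb_def inner_sum_left vertex_inner right_diff_distrib sum_subtractf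
      sum_distrib_right) (simp add: inner_vec_def)

lemma character_vertex:
  assumes "t \<in> carrier torus"
  shows "character (vertex i) t = monomial (A $ i) t / (\<Prod>j\<in>UNIV. t $ j)"
  using assms
  by (simp add: character_def vertex_def monomial_def torus_def power_int_diff prod_dividef)

lemma character_comb:
  assumes "t \<in> carrier torus"
  shows "character (comb a) t = (\<Prod>i\<in>UNIV. character (vertex i) t powi (a $ i))"
proof -
  have "character (comb a) t = (\<Prod>j\<in>UNIV. \<Prod>i\<in>UNIV. (t $ j powi (vertex i $ j)) powi (a $ i))"
    using assms by (simp add: character_def comb_def torus_def power_int_sum mult.commute flip: power_int_mult)
  also have "\<dots> = (\<Prod>i\<in>UNIV. \<Prod>j\<in>UNIV. (t $ j powi (vertex i $ j)) powi (a $ i))"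
    by (rule prod.swap)
  finally show ?thesis
    by (simp add: character_def prod_power_int)
qed

section \<open>The group G and the lattice M\<close>

abbreviation "G \<equiv> SL4_lift (G_max (\<lambda>u. matrix_poly A (vector [u $ 1, u $ 2, u $ 3, 0])))"

lemma matrix_poly_restrict:
  fixes u :: "complex ^ 3"
  assumes "x $ 1 = u $ 1" "x $ 2 = u $ 2" "x $ 3 = u $ 3"
  shows "matrix_poly A (vector [u $ 1, u $ 2, u $ 3, 0]) =
    (\<Sum>i\<in>UNIV. if i = 4 then 0 else monomial (A $ i) x)"
  unfolding matrix_poly_monomial
  by (rule sum.cong) (auto simp: monomial_def prod_4 last_column assms)

text \<open>The three monomials of f are treated as monomials in four variables, so their
  independence is inherited from the invertible 4 by 4 matrix.\<close>

lemma G_max_restrict: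
  assumes "t \<in> carrier torus"
  shows "(vector [t $ 1, t $ 2, t $ 3] :: complex ^ 3) \<in> G_max (\<lambda>u. matrix_poly A (vector [u $ 1, u $ 2, u $ 3, 0]))
    \<longleftrightarrow> (\<forall>i. i \<noteq> 4 \<longrightarrow> monomial (A $ i) t = 1)" (is "?s \<in> G_max ?f \<longleftrightarrow> _")
proof -
  have torus: "?s \<in> carrier torus"
    using assms by (simp add: torus_def forall_3 vector_3)
  have f: "?f u = (\<Sum>i\<in>UNIV. if i = 4 then 0 else monomial (A $ i) x)"
    and fs: "?f (?s * u) = (\<Sum>i\<in>UNIV. if i = 4 then 0 else monomial (A $ i) t * monomial (A $ i) x)"
    if "x $ 1 = u $ 1" "x $ 2 = u $ 2" "x $ 3 = u $ 3" for x u
    using matrix_poly_restrict[of x u] matrix_poly_restrict[of "t * x" "?s * u"] that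
    by (simp_all add: vector_3 monomial_mult cong: if_cong)
  show ?thesis
  proof (intro iffI allI impI)
    fix i :: 4
    assume s: "?s \<in> G_max ?f" and i: "i \<noteq> 4"
    \<comment> \<open>The coefficient 0 at the fourth monomial accounts for w = 0: the relation
      holds for every \<open>x\<close>, whatever its fourth coordinate.\<close>
    have "(if i = 4 then 0 else monomial (A $ i) t - 1) = 0"
    proof (rule monomials_independent[OF invertible, where c = "\<lambda>i. if i = 4 then 0 else monomial (A $ i) t - 1"])
      fix x :: "complex ^ 4"
      let ?u = "vector [x $ 1, x $ 2, x $ 3] :: complex ^ 3"
      have u: "x $ 1 = ?u $ 1" "x $ 2 = ?u $ 2" "x $ 3 = ?u $ 3"
        by (simp_all add: vector_3)
      have "(\<Sum>i\<in>UNIV. (if i = 4 then 0 else monomial (A $ i) t - 1) * monomial (A $ i) x) =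
          (\<Sum>i\<in>UNIV. if i = 4 then 0 else monomial (A $ i) t * monomial (A $ i) x) -
          (\<Sum>i\<in>UNIV. if i = 4 then 0 else monomial (A $ i) x)"
        by (subst sum_subtractf[symmetric], rule sum.cong) (auto simp: left_diff_distrib)
      also have "\<dots> = ?f (?s * ?u) - ?f ?u"
        by (simp only: f[OF u] fs[OF u])
      also have "?f (?s * ?u) = ?f ?u"
        using s unfolding G_max_def by blast
      finally show "(\<Sum>i\<in>UNIV. (if i = 4 then 0 else monomial (A $ i) t - 1) * monomial (A $ i) x) = 0"
        by (simp only: diff_self)
    qed
    then show "monomial (A $ i) t = 1"
      using i by simp
  next
    assume t: "\<forall>i. i \<noteq> 4 \<longrightarrow> monomial (A $ i) t = 1"
    have "?f (?s * u) = ?f u" for u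
    proof -
      define x :: "complex ^ 4" where "x = vector [u $ 1, u $ 2, u $ 3, 0]"
      have x: "x $ 1 = u $ 1" "x $ 2 = u $ 2" "x $ 3 = u $ 3"
        by (simp_all add: x_def)
      show ?thesis
        unfolding f[OF x] fs[OF x] using t by (intro sum.cong) auto
    qed
    then show "?s \<in> G_max ?f"
      using torus by (simp add: G_max_def)
  qed
qed

lemma G_iff:
  "t \<in> G \<longleftrightarrow> t \<in> carrier torus \<and> (\<Prod>j\<in>UNIV. t $ j) = 1 \<and> (\<forall>i. i \<noteq> 4 \<longrightarrow> monomial (A $ i) t = 1)"
proof
  assume "t \<in> G"
  then obtain a b c where t: "t = vector [a, b, c, inverse (a * b * c)]"
    and abc: "(vector [a, b, c] :: complex ^ 3) \<in> G_max (\<lambda>u. matrix_poly A (vector [u $ 1, u $ 2, u $ 3, 0]))"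
    unfolding SL4_lift_def by blast
  have nz: "a \<noteq> 0" "b \<noteq> 0" "c \<noteq> 0"
    using abc by (simp_all add: G_max_def torus_def forall_3 vector_3)
  then have "t \<in> carrier torus"
    by (simp add: t torus_def forall_4)
  moreover have "(\<Prod>j\<in>UNIV. t $ j) = 1"
    using nz by (simp add: t prod_4 field_simps)
  ultimately show "t \<in> carrier torus \<and> (\<Prod>j\<in>UNIV. t $ j) = 1 \<and> (\<forall>i. i \<noteq> 4 \<longrightarrow> monomial (A $ i) t = 1)"
    using G_max_restrict[of t] abc by (simp add: t)
next
  assume t: "t \<in> carrier torus \<and> (\<Prod>j\<in>UNIV. t $ j) = 1 \<and> (\<forall>i. i \<noteq> 4 \<longrightarrow> monomial (A $ i) t = 1)"
  then have "inverse (t $ 1 * t $ 2 * t $ 3) = t $ 4"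
    by (intro inverse_unique) (simp add: prod_4)
  then have "t = vector [t $ 1, t $ 2, t $ 3, inverse (t $ 1 * t $ 2 * t $ 3)]"
    by (simp add: vec_eq_iff forall_4)
  then show "t \<in> G"
    using t G_max_restrict[of t] unfolding SL4_lift_def by blast
qed

lemma G_torus: "G \<subseteq> carrier torus"
  by (auto simp: G_iff)

text \<open>Applying \<open>R\<close> to \<open>B *v real_vec a\<close> returns the integer vector
  \<open>a\<close>, so every monomial takes the value 1, and \<open>sum_B\<close> gives determinant
  1. These elements serve as test elements for both lattices.\<close>

lemma rho_word_in_G:
  assumes "(\<Sum>i\<in>UNIV. k $ i * a $ i) = 0"
  shows "rho_word A a \<in> G"
proof -
  have "real_vec k \<bullet> real_vec a = of_int (\<Sum>i\<in>UNIV. k $ i * a $ i)"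
    by (simp add: inner_vec_def)
  then have sum: "(\<Sum>j\<in>UNIV. (B *v real_vec a) $ j) = 0"
    by (simp add: sum_B assms)
  have "monomial (A $ i) (unit_exp (B *v real_vec a)) = 1" for i
  proof -
    have "real_vec (\<chi> j. int (A $ i $ j)) \<bullet> (B *v real_vec a) = (R *v (B *v real_vec a)) $ i"
      by (simp add: inner_vec_def matrix_vector_mult_def[of R])
    then show ?thesis
      by (simp add: monomial_eq_character character_unit_exp_eq_1_iff R_B)
  qed
  moreover have "(\<Prod>j\<in>UNIV. unit_exp (B *v real_vec a) $ j) = character (\<chi> j. 1) (unit_exp (B *v real_vec a))"
    by (simp add: character_def)
  moreover have "character (\<chi> j. 1) (unit_exp (B *v real_vec a)) = 1"
    by (simp add: character_unit_exp_eq_1_iff inner_vec_def sum)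
  ultimately show ?thesis
    by (simp add: rho_word_unit_exp G_iff unit_exp_torus)
qed

text \<open>Testing \<open>m\<close> on the elements of \<open>rho_word_in_G\<close> makes its
  coefficients with respect to the rows of \<open>A\<close> integral up to a multiple of
  \<open>k\<close>, and such a multiple is invisible to \<open>comb\<close>. For the converse, a
  combination of the first three vertices is trivial on \<open>G\<close>.\<close>

lemma character_lattice_eq:
  assumes w: "weight_system (matrix_poly A) q h"
  shows "character_lattice q G = range comb"
proof -
  define p :: "real ^ 4" where "p = (\<chi> j. real (q $ j))"
  have h: "h > 0"
    using w by (simp add: weight_system_def)
  have Rp: "R *v p = (\<chi> i. real h)"
    using arg_cong[OF weight_system_matrix_poly[OF invertible w], of real]
    by (simp add: vec_eq_iff matrix_vector_mult_def p_def)
  \<comment> \<open>Pairing A q = (h,...,h) with \<open>k\<close> yields q_1 + ... + q_4 =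
    h.\<close>
  have "real_vec k \<bullet> (\<chi> i. real h) = real h * of_int (\<Sum>i\<in>UNIV. k $ i)"
    by (simp add: inner_vec_def sum_distrib_left mult.commute)
  then have p_sum: "(\<Sum>j\<in>UNIV. p $ j) = real h"
    using weights_inner[of p] last_column(2) unfolding Rp weights_sum by simp
  have inner_p: "of_int (\<Sum>j\<in>UNIV. int (q $ j) * m $ j) = real_vec m \<bullet> p" for m
    by (simp add: inner_vec_def p_def mult.commute)
  show ?thesis
  proof (intro equalityI subsetI)
    fix m
    assume "m \<in> character_lattice q G"
    then have m: "\<And>t. t \<in> G \<Longrightarrow> character m t = 1" "real_vec m \<bullet> p = 0"
      using inner_p[of m] by (simp_all add: character_lattice_iff[OF G_torus])
    define c where "c = real_vec m v* B"
    have c_B: "real_vec m \<bullet> (B *v y) = c \<bullet> y" for y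
      by (simp add: c_def dot_lmul_matrix)
    have c_R: "c \<bullet> (R *v x) = real_vec m \<bullet> x" for x
      by (simp add: B_R flip: c_B)
    have "c \<bullet> (\<chi> i. real h) = real h * (\<Sum>i\<in>UNIV. c $ i)"
      by (simp add: inner_vec_def sum_distrib_left mult.commute)
    then have c_sum: "(\<Sum>i\<in>UNIV. c $ i) = 0"
      using c_R[of p] m(2) h by (simp add: Rp)
    have "c $ i - of_int (k $ i) * c $ 4 \<in> \<int>" for i
    proof -
      \<comment> \<open>The vector is the i-th axis vector minus \<open>k $ i\<close> times the
        fourth; it is orthogonal to \<open>k\<close> because \<open>k $ 4 = 1\<close>.\<close>
      let ?a = "\<chi> l. (if l = i then 1 else 0) - (if l = 4 then k $ i else 0)"
      have "(\<Sum>l\<in>UNIV. k $ l * ?a $ l) = 0"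
        by (simp add: right_diff_distrib sum_subtractf last_weight if_distrib[of "\<lambda>c. _ * c"] cong: if_cong)
      then have "real_vec m \<bullet> (B *v real_vec ?a) \<in> \<int>"
        using m(1)[OF rho_word_in_G[of ?a]]
        by (simp add: rho_word_unit_exp character_unit_exp_eq_1_iff)
      moreover have "c \<bullet> real_vec ?a = c $ i - of_int (k $ i) * c $ 4"
        by (simp add: inner_vec_def right_diff_distrib sum_subtractf if_distrib[of "\<lambda>c. _ * c"]
            if_distrib[of of_int] cong: if_cong)
      ultimately show ?thesis
        by (simp add: c_B)
    qed
    then have floor: "of_int \<lfloor>c $ i - of_int (k $ i) * c $ 4\<rfloor> = c $ i - of_int (k $ i) * c $ 4" for i
      by simp
    \<comment> \<open>The multiple of \<open>k\<close> is chosen so that the fourth coefficient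
      becomes 0; the others are integral by the test above, so \<open>floor\<close> merely changes
      their type.\<close>
    define n where "n = (\<chi> i. \<lfloor>c $ i - of_int (k $ i) * c $ 4\<rfloor>)"
    have n: "real_vec n = c - c $ 4 *\<^sub>R real_vec k"
      by (simp add: vec_eq_iff n_def floor)
    have k_sum: "(\<Sum>i\<in>UNIV. real_of_int (k $ i)) = real (A $ 4 $ 4)"
      using arg_cong[OF weights_sum, of real_of_int] by simp
    have "real_comb (real_vec n) \<bullet> x = real_vec m \<bullet> x" for x
      unfolding real_comb_inner n
      by (simp add: inner_diff_left c_R weights_inner sum_subtractf c_sum k_sum flip: sum_distrib_left)
    then have "real_comb (real_vec n) = real_vec m"
      using vector_eq_rdot by blast
    then have "comb n = m"
      by (simp add: real_comb_real_vec)
    then show "m \<in> range comb"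
      by auto
  next
    fix m
    assume "m \<in> range comb"
    then obtain b where "m = comb b"
      by blast
    then obtain a where m: "m = comb a" and a4: "a $ 4 = 0"
      using that[of "\<chi> i. b $ i - k $ i * b $ 4"] by (simp add: last_weight flip: comb_eq_reduced)
    have "real_vec m \<bullet> p = 0"
      by (simp add: m real_comb_def inner_sum_left vertex_inner Rp p_sum flip: real_comb_real_vec)
    then have "(\<Sum>j\<in>UNIV. int (q $ j) * m $ j) = 0"
      by (simp only: of_int_0_eq_iff flip: inner_p)
    moreover have "character m t = 1" if t: "t \<in> G" for t
    proof -
      have "character (vertex i) t powi (a $ i) = 1" for i
        using t a4 character_vertex[of t i] by (cases "i = 4") (auto simp: G_iff)
      then show ?thesis
        using t by (simp add: m character_comb G_iff)
    qed
    ultimately show "m \<in> character_lattice q G"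
      by (simp add: character_lattice_iff[OF G_torus])
  qed
qed

section \<open>The transposed weights and lattice\<close>

text \<open>The fourth column of \<open>A\<close> has the single nonzero entry a_44, which gives h =
  a_44 q_4. Then q - q_4 k lies in the left kernel of \<open>A\<close>, so q = q_4 k. Thus q_4
  divides all weights and h, and primitivity gives q_4 = 1.\<close>

lemma transpose_weights:
  assumes w: "weight_system (matrix_poly (transpose A)) q h"
  shows "int (q $ j) = k $ j"
proof -
  have inv: "invertible (real_mat (transpose A))"
    by (simp add: real_mat_transpose transpose_invertible invertible)
  have row: "(\<Sum>j\<in>UNIV. A $ j $ i * q $ j) = h" for i
    using weight_system_matrix_poly[OF inv w, of i] by (simp add: transpose_def)
  have "(\<Sum>j\<in>UNIV. A $ j $ 4 * q $ j) = (\<Sum>j::4\<in>UNIV. if j = 4 then A $ 4 $ 4 * q $ 4 else 0)"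
    by (rule sum.cong) (auto simp: last_column)
  then have h: "h = A $ 4 $ 4 * q $ 4"
    using row[of 4] by simp
  define d :: "real ^ 4" where "d = (\<chi> j. real (q $ j) - real (q $ 4) * of_int (k $ j))"
  have "(\<Sum>j\<in>UNIV. real (A $ j $ i) * d $ j) = 0" for i
  proof -
    have 1: "(\<Sum>j\<in>UNIV. real (A $ j $ i) * real (q $ j)) = real h"
      using arg_cong[OF row[of i], of real] by simp
    have 2: "(\<Sum>j\<in>UNIV. of_int (k $ j) * real (A $ j $ i)) = real (A $ 4 $ 4)"
      using arg_cong[OF weights[of i], of real_of_int] by simp
    have "(\<Sum>j\<in>UNIV. real (A $ j $ i) * d $ j) =
        (\<Sum>j\<in>UNIV. real (A $ j $ i) * real (q $ j)) - real (q $ 4) * (\<Sum>j\<in>UNIV. of_int (k $ j) * real (A $ j $ i))"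
      by (simp add: d_def right_diff_distrib sum_subtractf sum_distrib_left mult_ac)
    then show ?thesis
      by (simp add: 1 2 h)
  qed
  then have "d v* R = 0"
    by (simp add: vec_eq_iff vector_matrix_mult_def mult.commute)
  then have "d \<bullet> y = 0" for y
    using dot_lmul_matrix[of d R "B *v y"] by (simp add: R_B)
  then have "d = 0"
    using inner_eq_zero_iff by blast
  then have d: "d $ j = 0" for j
    by simp
  have real: "real (q $ j) = real (q $ 4) * of_int (k $ j)" for j
    using d[of j] by (simp add: d_def)
  have q: "int (q $ j) = int (q $ 4) * k $ j" for j
  proof -
    have "real_of_int (int (q $ j)) = real_of_int (int (q $ 4) * k $ j)"
      using real[of j] by simp
    then show ?thesis
      by (simp only: of_int_eq_iff)
  qed
  have "q $ 4 dvd q $ j" for j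
    using q[of j] by (metis dvd_triv_left int_dvd_int_iff)
  then have "q $ 4 dvd Gcd (insert h (range (\<lambda>j. q $ j)))"
    by (intro Gcd_greatest) (auto simp: h)
  also have "Gcd (insert h (range (\<lambda>j. q $ j))) = 1"
    using w by (simp only: weight_system_def)
  finally have "q $ 4 = 1"
    by simp
  then show ?thesis
    using q[of j] by simp
qed

text \<open>For \<open>m\<close> orthogonal to \<open>k\<close>, \<open>rho_word A m\<close> lies in
  \<open>G\<close>. The defining condition of the transpose group at a = m is then exactly the
  triviality of the character \<open>m\<close> on the element with exponents \<open>r\<close>,
  because the inverse of the transposed matrix is the transpose of \<open>B\<close>.\<close>

lemma transpose_character_lattice_eq:
  assumes w: "weight_system (matrix_poly (transpose A)) q h"
  shows "character_lattice q (transpose_group A G) = {m. (\<Sum>i\<in>UNIV. k $ i * m $ i) = 0}"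
proof -
  have torus: "transpose_group A G \<subseteq> carrier torus"
    by (auto simp: transpose_group_def G_max_def)
  have "character m t = 1"
    if m: "(\<Sum>i\<in>UNIV. k $ i * m $ i) = 0" and t: "t \<in> transpose_group A G" for m t
  proof -
    obtain r where r: "t = rho_word (transpose A) r"
      and "\<And>a. rho_word A a \<in> G \<Longrightarrow> real_vec r \<bullet> (B *v real_vec a) \<in> \<int>"
      using t by (auto simp: transpose_group_def)
    then have "real_vec r \<bullet> (B *v real_vec m) \<in> \<int>"
      using rho_word_in_G[OF m] by blast
    then show ?thesis
      by (simp add: r rho_word_unit_exp character_unit_exp_eq_1_iff inv_matrix_transpose[OF invertible]
          transpose_matrix_vector dot_lmul_matrix inner_commute[of "real_vec m"])
  qed
  then show ?thesis
    by (auto simp: character_lattice_iff[OF torus] transpose_weights[OF w])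
qed

section \<open>The dual of M and the isomorphism onto the transposed lattice\<close>

abbreviation "M \<equiv> range comb"

text \<open>For \<open>y\<close> orthogonal to \<open>k\<close> this is the functional with the
  value \<open>y $ i\<close> at the i-th vertex. The value 0 off the span follows the convention of
  \<open>dual_space\<close>.\<close>

definition functional :: "real ^ 4 \<Rightarrow> real ^ 4 \<Rightarrow> real" where
  "functional y x = (if x \<in> real_space M then x \<bullet> (B *v y) else 0)"

text \<open>This becomes \<Phi>, and its integral version \<open>int_vertex_values\<close> becomes
  \<phi>. Evaluation at four points makes sense for every function, so the map is linear on the
  whole function type.\<close>

definition vertex_values :: "(real ^ 4 \<Rightarrow> real) \<Rightarrow> real ^ 4" where
  "vertex_values \<nu> = (\<chi> i. \<nu> (real_vec (vertex i)))"

definition int_vertex_values :: "(int ^ 4 \<Rightarrow> int) \<Rightarrow> int ^ 4" where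
  "int_vertex_values n = (\<chi> i. n (vertex i))"

lemma subspace_real_space: "subspace (real_space M)"
  by (simp add: real_space_def)

lemma vertex_in_real_space: "real_vec (vertex i) \<in> real_space M"
  unfolding real_space_def by (rule span_base) (simp flip: comb_axis)

lemma real_space_eq: "real_space M = range real_comb"
proof
  show "real_space M \<subseteq> range real_comb"
    unfolding real_space_def
  proof (rule span_minimal)
    show "real_vec ` M \<subseteq> range real_comb"
      by (auto simp flip: real_comb_real_vec)
    show "subspace (range real_comb)"
      by (rule linear_subspace_image[OF linear_real_comb subspace_UNIV])
  qed
  show "range real_comb \<subseteq> real_space M"
    by (auto simp: real_comb_def intro!: subspace_sum subspace_scale subspace_real_space vertex_in_real_space)
qed

lemma dual_space_real_comb:
  assumes "\<nu> \<in> dual_space M"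
  shows "\<nu> (real_comb x) = x \<bullet> vertex_values \<nu>"
proof -
  have add: "\<nu> (u + v) = \<nu> u + \<nu> v" if "u \<in> real_space M" "v \<in> real_space M" for u v
    using assms that by (simp add: dual_space_def)
  have scale: "\<nu> (c *\<^sub>R u) = c * \<nu> u" if "u \<in> real_space M" for u c
    using assms that by (simp add: dual_space_def)
  have zero: "\<nu> 0 = 0"
    using scale[OF vertex_in_real_space, of 0] by simp
  have "\<nu> (\<Sum>i\<in>S. x $ i *\<^sub>R real_vec (vertex i)) = (\<Sum>i\<in>S. x $ i * \<nu> (real_vec (vertex i)))"
    if "finite S" for S
    using that
  proof induction
    case empty
    then show ?case by (simp add: zero)
  next
    case (insert i S)
    have "(\<Sum>i\<in>S. x $ i *\<^sub>R real_vec (vertex i)) \<in> real_space M"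
      by (intro subspace_sum subspace_scale subspace_real_space vertex_in_real_space)
    then show ?case
      using insert by (simp add: add scale subspace_scale subspace_real_space vertex_in_real_space)
  qed
  from this[of UNIV] show ?thesis
    by (simp add: real_comb_def vertex_values_def inner_vec_def)
qed

lemma linear_vertex_values: "linear vertex_values"
  by (intro linearI) (simp_all add: vec_eq_iff vertex_values_def scaleR_fun_def)

lemma linear_functional: "linear functional"
  by (intro linearI) (simp_all add: fun_eq_iff functional_def scaleR_fun_def matrix_vector_right_distrib
      matrix_vector_mult_scaleR inner_add_right)

lemma functional_in_dual_space: "functional y \<in> dual_space M"
  by (simp add: dual_space_def functional_def subspace_add subspace_scale subspace_real_space inner_add_left)

lemma functional_real_comb: "real_vec k \<bullet> y = 0 \<Longrightarrow> functional y (real_comb x) = x \<bullet> y"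
  by (simp add: functional_def real_space_eq real_comb_inner_B)

lemma vertex_values_functional: "real_vec k \<bullet> y = 0 \<Longrightarrow> vertex_values (functional y) = y"
  by (simp add: vec_eq_iff vertex_values_def functional_def vertex_in_real_space vertex_inner_B)

lemma weights_vertex_values:
  assumes "\<nu> \<in> dual_space M"
  shows "real_vec k \<bullet> vertex_values \<nu> = 0"
proof -
  have "real_comb (real_vec k) = real_comb 0"
    by (simp add: real_comb_real_vec comb_k linear_0[OF linear_real_comb] vec_eq_iff)
  then show ?thesis
    using dual_space_real_comb[OF assms, of "real_vec k"] dual_space_real_comb[OF assms, of 0] by simp
qed

lemma functional_vertex_values:
  assumes "\<nu> \<in> dual_space M"
  shows "functional (vertex_values \<nu>) = \<nu>"
proof
  fix x
  show "functional (vertex_values \<nu>) x = \<nu> x"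
  proof (cases "x \<in> real_space M")
    case True
    then obtain c where "x = real_comb c"
      by (auto simp: real_space_eq)
    then show ?thesis
      by (simp add: functional_real_comb weights_vertex_values dual_space_real_comb assms)
  next
    case False
    then show ?thesis
      using assms by (simp add: functional_def dual_space_def)
  qed
qed

lemma dual_lattice_comb:
  assumes "n \<in> dual_lattice M"
  shows "n (comb a) = (\<Sum>i\<in>UNIV. a $ i * int_vertex_values n $ i)"
proof -
  have "n (comb (a + b)) = n (comb a) + n (comb b)" for a b
    using assms by (simp add: comb_add dual_lattice_def hom_def additive_group_def)
  from additive_int_vec[of "\<lambda>a. n (comb a)", OF this] show ?thesis
    by (simp add: comb_axis int_vertex_values_def)
qed

lemma weights_int_vertex_values:
  assumes "n \<in> dual_lattice M"
  shows "(\<Sum>i\<in>UNIV. k $ i * int_vertex_values n $ i) = 0"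
proof -
  have "comb k = comb 0"
    by (simp add: comb_k) (simp add: vec_eq_iff comb_def)
  then show ?thesis
    using dual_lattice_comb[OF assms, of k] dual_lattice_comb[OF assms, of 0] by simp
qed

lemma weights_inner_real_vec: "real_vec k \<bullet> real_vec m = of_int (\<Sum>i\<in>UNIV. k $ i * m $ i)"
  by (simp add: inner_vec_def)

lemma real_ext_eq:
  assumes "n \<in> dual_lattice M"
  shows "real_ext M n = functional (real_vec (int_vertex_values n))"
  unfolding real_ext_def
proof (rule the_equality)
  have k: "real_vec k \<bullet> real_vec (int_vertex_values n) = 0"
    by (simp add: weights_inner_real_vec weights_int_vertex_values[OF assms])
  have "functional (real_vec (int_vertex_values n)) (real_vec (comb a)) = of_int (n (comb a))" for a
    unfolding real_comb_real_vec[symmetric] functional_real_comb[OF k] dual_lattice_comb[OF assms]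
    by (simp add: inner_vec_def)
  then show "functional (real_vec (int_vertex_values n)) \<in> dual_space M \<and>
      (\<forall>m\<in>M. functional (real_vec (int_vertex_values n)) (real_vec m) = of_int (n m))"
    using functional_in_dual_space by blast
next
  fix \<nu>
  assume \<nu>: "\<nu> \<in> dual_space M \<and> (\<forall>m\<in>M. \<nu> (real_vec m) = of_int (n m))"
  have "vertex i \<in> M" for i
    by (simp flip: comb_axis)
  then have "\<nu> (real_vec (vertex i)) = of_int (n (vertex i))" for i
    using \<nu> by blast
  then have "vertex_values \<nu> = real_vec (int_vertex_values n)"
    by (simp add: vec_eq_iff vertex_values_def int_vertex_values_def)
  then show "\<nu> = functional (real_vec (int_vertex_values n))"
    using functional_vertex_values[of \<nu>] \<nu> by simp
qed

lemma int_vertex_values_surj: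
  assumes "(\<Sum>i\<in>UNIV. k $ i * m $ i) = 0"
  shows "\<exists>n\<in>dual_lattice M. int_vertex_values n = m"
proof -
  \<comment> \<open>The pairing is an integer on M, as shown next for \<open>comb a\<close>;
    \<open>floor\<close> only converts it to type \<open>int\<close>.\<close>
  define n where "n x = (if x \<in> M then \<lfloor>real_vec x \<bullet> (B *v real_vec m)\<rfloor> else 0)" for x
  have k: "real_vec k \<bullet> real_vec m = 0"
    by (simp add: weights_inner_real_vec assms)
  have comb: "n (comb a) = (\<Sum>i\<in>UNIV. a $ i * m $ i)" for a
  proof -
    have "real_vec (comb a) \<bullet> (B *v real_vec m) = of_int (\<Sum>i\<in>UNIV. a $ i * m $ i)"
      unfolding real_comb_real_vec[symmetric] real_comb_inner_B[OF k] by (simp add: inner_vec_def)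
    then show ?thesis
      unfolding n_def by (simp only: floor_of_int rangeI if_True)
  qed
  have "n (comb a + comb b) = n (comb a) + n (comb b)" for a b
    by (simp only: comb_add[symmetric] comb) (simp add: distrib_right sum.distrib)
  then have "n \<in> dual_lattice M"
    by (auto simp: dual_lattice_def hom_def additive_group_def n_def)
  moreover have "int_vertex_values n = m"
    by (simp add: vec_eq_iff int_vertex_values_def comb axis_def if_distrib[of "\<lambda>c. c * _"]
        flip: comb_axis cong: if_cong)
  ultimately show ?thesis
    by blast
qed

lemma int_vertex_values_iso:
  "int_vertex_values \<in> iso (additive_group (dual_lattice M)) (additive_group {m. (\<Sum>i\<in>UNIV. k $ i * m $ i) = 0})"
  unfolding iso_def bij_betw_def
proof (intro CollectI conjI)
  show "int_vertex_values \<in> hom (additive_group (dual_lattice M)) (additive_group {m. (\<Sum>i\<in>UNIV. k $ i * m $ i) = 0})"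
    by (auto simp: hom_def additive_group_def weights_int_vertex_values)
      (simp add: vec_eq_iff int_vertex_values_def)
  show "inj_on int_vertex_values (carrier (additive_group (dual_lattice M)))"
  proof (rule inj_onI, rule ext)
    fix n n' x
    assume "n \<in> carrier (additive_group (dual_lattice M))" "n' \<in> carrier (additive_group (dual_lattice M))"
      and eq: "int_vertex_values n = int_vertex_values n'"
    then have n: "n \<in> dual_lattice M" "n' \<in> dual_lattice M"
      by (simp_all add: additive_group_def)
    show "n x = n' x"
    proof (cases "x \<in> M")
      case True
      then show ?thesis
        using eq by (auto simp: dual_lattice_comb[OF n(1)] dual_lattice_comb[OF n(2)])
    next
      case False
      then show ?thesis
        using n by (simp add: dual_lattice_def)
    qed
  qed
  show "int_vertex_values ` carrier (additive_group (dual_lattice M)) =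
      carrier (additive_group {m. (\<Sum>i\<in>UNIV. k $ i * m $ i) = 0})"
    using int_vertex_values_surj weights_int_vertex_values by (fastforce simp: additive_group_def)
qed

section \<open>Reflexivity and the two inclusions\<close>

text \<open>In the coordinates \<open>vertex_values\<close> the polar of the hull of all vertices
  and all \<open>comb c\<close> is the set in \<open>polar_pair\<close>, whose vertices are
  integral. The bound on \<open>comb c\<close> places the transposed Newton polytope inside
  it.\<close>

lemma mirror_polytopes:
  assumes pair: "polar_pair k X W" and X: "\<And>c j. c \<in> X \<Longrightarrow> comb c $ j \<ge> -1"
  shows "\<exists>\<Delta>. reflexive_polytope M \<Delta> \<and> newton_polytope A \<subseteq> \<Delta> \<and>
    newton_polytope (transpose A) \<subseteq> vertex_values ` polar_dual M \<Delta>"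
proof -
  \<comment> \<open>The axis vectors stand for the Newton vertices, so the bounds on the coordinates
    of \<open>y\<close> and the cuts from \<open>X\<close> take the same form.\<close>
  define C where "C = range (\<lambda>i. axis i 1) \<union> X"
  define \<Delta> where "\<Delta> = convex hull (real_vec ` comb ` C)"
  define P where "P = {y. real_vec k \<bullet> y = 0 \<and> (\<forall>i. y $ i \<ge> -1) \<and> (\<forall>c\<in>X. real_vec c \<bullet> y \<ge> -1)}"
  have P: "P = convex hull (real_vec ` W)" and fin: "finite X" "finite W"
    using pair by (simp_all add: polar_pair_def P_def)
  have P_C: "y \<in> P \<longleftrightarrow> real_vec k \<bullet> y = 0 \<and> (\<forall>c\<in>C. real_vec c \<bullet> y \<ge> -1)" for y
  proof -
    have "real_vec (axis i 1) \<bullet> y = y $ i" for i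
      by (simp add: inner_vec_def axis_def if_distrib[of of_int] if_distrib[of "\<lambda>c. c * _"] cong: if_cong)
    then show ?thesis
      by (simp add: P_def C_def ball_Un)
  qed
  have polar: "polar_dual M \<Delta> = functional ` P"
  proof (intro equalityI subsetI)
    fix \<nu>
    assume "\<nu> \<in> polar_dual M \<Delta>"
    then have \<nu>: "\<nu> \<in> dual_space M" "\<And>x. x \<in> \<Delta> \<Longrightarrow> \<nu> x \<ge> -1"
      by (simp_all add: polar_dual_def)
    have "real_vec c \<bullet> vertex_values \<nu> \<ge> -1" if "c \<in> C" for c
    proof -
      have "real_comb (real_vec c) \<in> \<Delta>"
        by (simp add: \<Delta>_def real_comb_real_vec hull_inc that)
      from \<nu>(2)[OF this] show ?thesis
        by (simp add: dual_space_real_comb[OF \<nu>(1)])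
    qed
    then have "vertex_values \<nu> \<in> P"
      using weights_vertex_values[OF \<nu>(1)] by (simp add: P_C)
    then show "\<nu> \<in> functional ` P"
      using functional_vertex_values[OF \<nu>(1)] by (metis imageI)
  next
    fix \<nu>
    assume "\<nu> \<in> functional ` P"
    then obtain y where y: "y \<in> P" and \<nu>: "\<nu> = functional y"
      by blast
    then have k: "real_vec k \<bullet> y = 0"
      by (simp add: P_C)
    have "\<Delta> \<subseteq> {x. (B *v y) \<bullet> x \<ge> -1}"
      unfolding \<Delta>_def
    proof (rule hull_minimal)
      show "real_vec ` comb ` C \<subseteq> {x. (B *v y) \<bullet> x \<ge> -1}"
        using y by (auto simp: P_C inner_commute[of "B *v y"] real_comb_inner_B[OF k] simp flip: real_comb_real_vec)
    qed (rule convex_halfspace_ge)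
    then show "\<nu> \<in> polar_dual M \<Delta>"
      by (auto simp: polar_dual_def \<nu> functional_in_dual_space functional_def inner_commute)
  qed
  have "reflexive_polytope M \<Delta>"
    unfolding reflexive_polytope_def lattice_polytope_def
  proof (intro conjI exI)
    show "finite (real_vec ` comb ` C)"
      by (simp add: C_def fin)
    show "real_vec ` comb ` C \<subseteq> real_vec ` M"
      by blast
    show "\<Delta> = convex hull (real_vec ` comb ` C)"
      by (rule \<Delta>_def)
    show "finite (functional ` real_vec ` W)"
      by (simp add: fin)
    show "functional ` real_vec ` W \<subseteq> real_ext M ` dual_lattice M"
    proof clarify
      fix w
      assume "w \<in> W"
      then have "real_vec w \<in> P"
        by (simp add: P hull_inc)
      then have "real_of_int (\<Sum>i\<in>UNIV. k $ i * w $ i) = 0"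
        by (simp only: P_C weights_inner_real_vec)
      then have "(\<Sum>i\<in>UNIV. k $ i * w $ i) = 0"
        by (simp only: of_int_eq_0_iff)
      then obtain n where "n \<in> dual_lattice M" "int_vertex_values n = w"
        using int_vertex_values_surj by blast
      then show "functional (real_vec w) \<in> real_ext M ` dual_lattice M"
        using real_ext_eq by (metis imageI)
    qed
    show "polar_dual M \<Delta> = convex hull (functional ` real_vec ` W)"
      by (simp add: polar P convex_hull_linear_image[OF linear_functional])
  qed
  moreover have "newton_polytope A \<subseteq> \<Delta>"
    unfolding newton_polytope_def \<Delta>_def
  proof (rule hull_mono, clarify)
    fix i
    have "real_vec (comb (axis i 1)) \<in> real_vec ` comb ` C"
      by (simp add: C_def)
    then show "real_vec (\<chi> j. int (A $ i $ j) - 1) \<in> real_vec ` comb ` C"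
      by (simp only: comb_axis vertex_def)
  qed
  moreover have "newton_polytope (transpose A) \<subseteq> vertex_values ` polar_dual M \<Delta>"
  proof -
    have "vertex_values ` polar_dual M \<Delta> = P"
      unfolding polar image_image using vertex_values_functional by (auto simp: P_def)
    moreover have "newton_polytope (transpose A) \<subseteq> P"
      unfolding newton_polytope_def
    proof (rule hull_minimal)
      show "convex P"
        by (simp add: P)
      \<comment> \<open>The transposed exponents are the columns of \<open>A\<close> minus 1, so
        pairing them with \<open>c\<close> gives the entries of \<open>comb c\<close>. For c = k
        this is 0, and for \<open>c\<close> in \<open>X\<close> it is at least -1.\<close>
      have inner: "real_vec c \<bullet> real_vec (\<chi> j. int (transpose A $ i $ j) - 1) = of_int (comb c $ i)" for c i
        by (simp add: inner_vec_def comb_def vertex_def transpose_def)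
      show "range (\<lambda>i. real_vec (\<chi> j. int (transpose A $ i $ j) - 1)) \<subseteq> P"
        using X unfolding P_def by (auto simp: inner comb_k) (simp add: of_int_le_iff[of "-1", simplified])
    qed
    ultimately show ?thesis
      by simp
  qed
  ultimately show ?thesis
    by blast
qed

end

lemma (in weighted_matrix) mirror_duality:
  assumes "weight_system (matrix_poly A) q h" and "weight_system (matrix_poly (transpose A)) q' h'"
    and "polar_pair k X W" and "\<And>c j. c \<in> X \<Longrightarrow> (\<Sum>i\<in>UNIV. c $ i * (int (A $ i $ j) - 1)) \<ge> -1"
    and "L = character_lattice q G" and "L' = character_lattice q' (transpose_group A G)"
  shows "\<exists>\<phi> \<Phi> \<Delta>.
      \<phi> \<in> iso (additive_group (dual_lattice L)) (additive_group L') \<and>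
      linear \<Phi> \<and> (\<forall>n \<in> dual_lattice L. \<Phi> (real_ext L n) = real_vec (\<phi> n)) \<and>
      reflexive_polytope L \<Delta> \<and>
      newton_polytope A \<subseteq> \<Delta> \<and>
      newton_polytope (transpose A) \<subseteq> \<Phi> ` polar_dual L \<Delta>"
proof -
  have L: "L = M" and L': "L' = {m. (\<Sum>i\<in>UNIV. k $ i * m $ i) = 0}"
    using assms by (simp_all add: character_lattice_eq transpose_character_lattice_eq)
  have "comb c $ j \<ge> -1" if "c \<in> X" for c j
    using assms(4)[OF that] by (simp add: comb_def vertex_def)
  from mirror_polytopes[OF assms(3) this] obtain \<Delta> where
    "reflexive_polytope M \<Delta>" "newton_polytope A \<subseteq> \<Delta>"
    "newton_polytope (transpose A) \<subseteq> vertex_values ` polar_dual M \<Delta>"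
    by blast
  moreover have "vertex_values (real_ext M n) = real_vec (int_vertex_values n)" if "n \<in> dual_lattice M" for n
    by (simp add: real_ext_eq that vertex_values_functional weights_inner_real_vec weights_int_vertex_values)
  ultimately show ?thesis
    unfolding L L' using int_vertex_values_iso linear_vertex_values by blast
qed

section \<open>Explicit polar pairs\<close>

text \<open>The set cut out by the inequalities is convex, so one inclusion is a finite check on
  integer points; the other is left to barycentric coordinates.\<close>

lemma polar_pairI:
  fixes k :: "int ^ 4"
  assumes "finite X"
    and W: "\<And>w. w \<in> set ws \<Longrightarrow> (\<Sum>i\<in>UNIV. k $ i * w $ i) = 0 \<and> (\<forall>i. -1 \<le> w $ i) \<and>
      (\<forall>c\<in>X. -1 \<le> (\<Sum>i\<in>UNIV. c $ i * w $ i))"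
    and hull: "\<And>y :: real ^ 4. (\<Sum>i\<in>UNIV. of_int (k $ i) * y $ i) = 0 \<Longrightarrow> (\<forall>i. -1 \<le> y $ i) \<Longrightarrow>
      (\<forall>c\<in>X. -1 \<le> (\<Sum>i\<in>UNIV. of_int (c $ i) * y $ i)) \<Longrightarrow> y \<in> convex hull (real_vec ` set ws)"
  shows "polar_pair k X (set ws)"
proof -
  let ?P = "{y. real_vec k \<bullet> y = 0 \<and> (\<forall>i. y $ i \<ge> -1) \<and> (\<forall>c\<in>X. real_vec c \<bullet> y \<ge> -1)}"
  have "?P = {y. real_vec k \<bullet> y = 0} \<inter> (\<Inter>i. {y. axis i 1 \<bullet> y \<ge> -1}) \<inter> (\<Inter>c\<in>X. {y. real_vec c \<bullet> y \<ge> -1})"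
    by (auto simp: inner_axis')
  then have "convex ?P"
    by (simp only:) (intro convex_Int convex_INT convex_hyperplane convex_halfspace_ge)
  moreover have "real_vec w \<in> ?P" if "w \<in> set ws" for w
  proof -
    have inner: "real_vec c \<bullet> real_vec w = of_int (\<Sum>i\<in>UNIV. c $ i * w $ i)" for c
      by (simp add: inner_vec_def)
    have le: "(-1 :: real) \<le> of_int z \<longleftrightarrow> -1 \<le> z" for z
      by linarith
    show ?thesis
      unfolding mem_Collect_eq inner real_vec_nth le of_int_eq_0_iff using W[OF that] by blast
  qed
  ultimately have "convex hull (real_vec ` set ws) \<subseteq> ?P"
    by (intro hull_minimal) auto
  moreover have "?P \<subseteq> convex hull (real_vec ` set ws)"
    using hull by (auto simp: inner_vec_def)
  ultimately show ?thesis
    using \<open>finite X\<close> by (auto simp: polar_pair_def)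
qed

lemma in_convex_hull_real_vec:
  fixes y :: "real ^ 4"
  assumes us: "length us = length ws" "list_all ((\<le>) 0) us" "sum_list us = 1"
    and y: "\<forall>i. y $ i = sum_list (map2 (\<lambda>u w. u * of_int (w $ i)) us ws)"
  shows "y \<in> convex hull (real_vec ` set ws)"
proof -
  have "sum_list vs $ i = sum_list (map (\<lambda>v. v $ i) vs)" for vs :: "(real ^ 4) list" and i
    by (induction vs) simp_all
  then have "y = sum_list (map2 (*\<^sub>R) us (map real_vec ws))"
    using y by (simp add: vec_eq_iff zip_map2 case_prod_unfold o_def)
  moreover have "sum_list (map2 (*\<^sub>R) us (map real_vec ws)) \<in> convex hull (set (map real_vec ws))"
    using us by (intro sum_list_in_convex_hull) (auto simp: list_all_iff)
  ultimately show ?thesis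
    by simp
qed

lemmas barycentric_simps =
  list.map zip_Cons_Cons zip.simps(1) prod.case sum_list.Cons sum_list.Nil list.pred_inject(2) list.size
  forall_4 vector_4 of_int_numeral of_int_neg_numeral of_int_1 of_int_0 of_int_minus
  add_divide_distrib diff_divide_distrib distrib_right left_diff_distrib

text \<open>
  In each of the following lemmas the polytope is triangulated, and the list passed to
  \<open>in_convex_hull_real_vec\<close> contains the barycentric coordinates of \<open>y\<close> in the simplex selected by
  the case distinction.
\<close>

lemma polar_pair_2_6_9:
  "polar_pair (vector [2, 6, 9, 1] :: int ^ 4) {}
    (set [vector [-1, -1, -1, 17],
      vector [-1, -1, 1, -1],
      vector [-1, 2, -1, -1],
      vector [8, -1, -1, -1]])"
    (is "polar_pair ?k ?X (set ?ws)")
proof (rule polar_pairI)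
  fix y :: "real ^ 4"
  assume "(\<Sum>i\<in>UNIV. of_int (?k $ i) * y $ i) = 0" "\<forall>i. -1 \<le> y $ i"
    "\<forall>c\<in>?X. -1 \<le> (\<Sum>i\<in>UNIV. of_int (c $ i) * y $ i)"
  then have y: "2 * y $ 1 + 6 * y $ 2 + 9 * y $ 3 + y $ 4 = 0"
    "-1 \<le> y $ 1" "-1 \<le> y $ 2" "-1 \<le> y $ 3" "-1 \<le> y $ 4"
    by (simp_all add: sum_4 forall_4)
  \<comment> \<open>In a simplex k.y = 0, y_i >= -1 of degree h, the coordinate belonging to the
    vertex opposite to y_i = -1 is k_i (1 + y_i)/h; here h = 18, and y_4 is eliminated.\<close>
  show "y \<in> convex hull (real_vec ` set ?ws)"
    using y
    by - (rule in_convex_hull_real_vec[of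
        "[(1 - 2 * y $ 1 - 6 * y $ 2 - 9 * y $ 3) / 18, (1 + y $ 3) / 2, (1 + y $ 2) / 3,
         (1 + y $ 1) / 9]"],
      unfold barycentric_simps, (intro conjI refl list.pred_inject(1) | linarith)+)
qed (auto simp: sum_4 forall_4)

text \<open>The cut removes the vertex with y_2 = 5/2. For x^5 y + x y^3 + z^2 + w^14 it comes from
  the monomial x^4 w^6.\<close>

lemma polar_pair_2_4_7:
  "polar_pair (vector [2, 4, 7, 1] :: int ^ 4) {vector [0, -2, -3, 0]}
    (set [vector [-1, -1, -1, 13],
      vector [-1, -1, 1, -1],
      vector [-1, 2, -1, 1],
      vector [0, 2, -1, -1],
      vector [6, -1, -1, -1]])"
    (is "polar_pair ?k ?X (set ?ws)")
proof (rule polar_pairI)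
  fix y :: "real ^ 4"
  assume "(\<Sum>i\<in>UNIV. of_int (?k $ i) * y $ i) = 0" "\<forall>i. -1 \<le> y $ i"
    "\<forall>c\<in>?X. -1 \<le> (\<Sum>i\<in>UNIV. of_int (c $ i) * y $ i)"
  then have y: "2 * y $ 1 + 4 * y $ 2 + 7 * y $ 3 + y $ 4 = 0"
    "-1 \<le> y $ 1" "-1 \<le> y $ 2" "-1 \<le> y $ 3" "-1 \<le> y $ 4"
    "-1 \<le> - 2 * y $ 2 - 3 * y $ 3"
    by (simp_all add: sum_4 forall_4)
  show "y \<in> convex hull (real_vec ` set ?ws)"
  \<comment> \<open>This plane contains the first, second and fourth listed vertices and separates
    the other two, so it splits the polytope into two simplices.\<close>
  proof (cases "0 \<le> 2 + 3 * y $ 1 - y $ 2")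
    case True
    show ?thesis
      using y True
      by - (rule in_convex_hull_real_vec[of
          "[(1 - 2 * y $ 1 - 4 * y $ 2 - 7 * y $ 3) / 14, (1 + y $ 3) / 2, 0, (1 + y $ 2) / 3,
           (2 + 3 * y $ 1 - y $ 2) / 21]"],
        unfold barycentric_simps, (intro conjI refl list.pred_inject(1) | linarith)+)
  next
    case False
    show ?thesis
      using y False
      by - (rule in_convex_hull_real_vec[of
          "[(1 - 2 * y $ 2 - 3 * y $ 3) / 6, (1 + y $ 3) / 2, (y $ 2 - 2 - 3 * y $ 1) / 3,
           1 + y $ 1, 0]"],
        unfold barycentric_simps, (intro conjI refl list.pred_inject(1) | linarith)+)
  qed
qed (auto simp: sum_4 forall_4)

text \<open>In x^4 z + x y^3 + z^2 + w^12 the monomial x^4 z is the midpoint of x^8 and z^2. Adding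
  x^8 replaces the facet y_1 = -1, and the polar is again a simplex.\<close>

lemma polar_pair_2_4_5:
  "polar_pair (vector [2, 4, 5, 1] :: int ^ 4) {vector [2, 0, -1, 0]}
    (set [vector [-1, -1, -1, 11],
      vector [-1, 2, -1, -1],
      vector [0, -1, 1, -1],
      vector [5, -1, -1, -1]])"
    (is "polar_pair ?k ?X (set ?ws)")
proof (rule polar_pairI)
  fix y :: "real ^ 4"
  assume "(\<Sum>i\<in>UNIV. of_int (?k $ i) * y $ i) = 0" "\<forall>i. -1 \<le> y $ i"
    "\<forall>c\<in>?X. -1 \<le> (\<Sum>i\<in>UNIV. of_int (c $ i) * y $ i)"
  then have y: "2 * y $ 1 + 4 * y $ 2 + 5 * y $ 3 + y $ 4 = 0"
    "-1 \<le> y $ 1" "-1 \<le> y $ 2" "-1 \<le> y $ 3" "-1 \<le> y $ 4"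
    "-1 \<le> 2 * y $ 1 - y $ 3"
    by (simp_all add: sum_4 forall_4)
  show "y \<in> convex hull (real_vec ` set ?ws)"
    using y
    by - (rule in_convex_hull_real_vec[of
        "[(1 - 2 * y $ 1 - 4 * y $ 2 - 5 * y $ 3) / 12, (1 + y $ 2) / 3, (1 + y $ 3) / 2,
         (1 + 2 * y $ 1 - y $ 3) / 12]"],
      unfold barycentric_simps, (intro conjI refl list.pred_inject(1) | linarith)+)
qed (auto simp: sum_4 forall_4)

lemma polar_pair_2_6_3:
  "polar_pair (vector [2, 6, 3, 1] :: int ^ 4) {}
    (set [vector [-1, -1, -1, 11],
      vector [-1, -1, 3, -1],
      vector [-1, 1, -1, -1],
      vector [5, -1, -1, -1]])"
    (is "polar_pair ?k ?X (set ?ws)")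
proof (rule polar_pairI)
  fix y :: "real ^ 4"
  assume "(\<Sum>i\<in>UNIV. of_int (?k $ i) * y $ i) = 0" "\<forall>i. -1 \<le> y $ i"
    "\<forall>c\<in>?X. -1 \<le> (\<Sum>i\<in>UNIV. of_int (c $ i) * y $ i)"
  then have y: "2 * y $ 1 + 6 * y $ 2 + 3 * y $ 3 + y $ 4 = 0"
    "-1 \<le> y $ 1" "-1 \<le> y $ 2" "-1 \<le> y $ 3" "-1 \<le> y $ 4"
    by (simp_all add: sum_4 forall_4)
  show "y \<in> convex hull (real_vec ` set ?ws)"
    using y
    by - (rule in_convex_hull_real_vec[of
        "[(1 - 2 * y $ 1 - 6 * y $ 2 - 3 * y $ 3) / 12, (1 + y $ 3) / 4, (1 + y $ 2) / 2,
         (1 + y $ 1) / 6]"],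
      unfold barycentric_simps, (intro conjI refl list.pred_inject(1) | linarith)+)
qed (auto simp: sum_4 forall_4)

text \<open>The two cuts remove the vertices with y_3 = 7/3 and y_2 = 3/2 respectively. For x^5 y +
  y^2 z + z^2 + w^10 they come from x y w^6 and x^4 w^4.\<close>

lemma polar_pair_2_4_3:
  "polar_pair (vector [2, 4, 3, 1] :: int ^ 4) {vector [-1, -2, -2, 0], vector [0, -2, -1, 0]}
    (set [vector [-1, -1, -1, 9],
      vector [-1, -1, 2, 0],
      vector [-1, 0, 1, -1],
      vector [-1, 1, -1, 1],
      vector [0, 1, -1, -1],
      vector [1, -1, 1, -1],
      vector [4, -1, -1, -1]])"
    (is "polar_pair ?k ?X (set ?ws)")
proof (rule polar_pairI)
  fix y :: "real ^ 4"
  assume "(\<Sum>i\<in>UNIV. of_int (?k $ i) * y $ i) = 0" "\<forall>i. -1 \<le> y $ i"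
    "\<forall>c\<in>?X. -1 \<le> (\<Sum>i\<in>UNIV. of_int (c $ i) * y $ i)"
  then have y: "2 * y $ 1 + 4 * y $ 2 + 3 * y $ 3 + y $ 4 = 0"
    "-1 \<le> y $ 1" "-1 \<le> y $ 2" "-1 \<le> y $ 3" "-1 \<le> y $ 4"
    "-1 \<le> - y $ 1 - 2 * y $ 2 - 2 * y $ 3" "-1 \<le> - 2 * y $ 2 - y $ 3"
    by (simp_all add: sum_4 forall_4)
  show "y \<in> convex hull (real_vec ` set ?ws)"
  \<comment> \<open>The plane contains the first, third and last listed vertices and has two of the
    remaining vertices on each side; each half is then split into two simplices.\<close>
  proof (cases "0 \<le> 1 + 2 * y $ 2 - y $ 3")
    case True
    note c0 = this
    show ?thesis
    proof (cases "0 \<le> 3 + 4 * y $ 1 + y $ 3 - 2 * y $ 2")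
      case True
      show ?thesis
        using y c0 True
        by - (rule in_convex_hull_real_vec[of
            "[(1 - 2 * y $ 1 - 4 * y $ 2 - 3 * y $ 3) / 10, 0, (1 + y $ 3) / 2, 0,
             (1 + 2 * y $ 2 - y $ 3) / 4, 0, (3 + 4 * y $ 1 + y $ 3 - 2 * y $ 2) / 20]"],
          unfold barycentric_simps, (intro conjI refl list.pred_inject(1) | linarith)+)
    next
      case False
      show ?thesis
        using y c0 False
        by - (rule in_convex_hull_real_vec[of
            "[(1 - 2 * y $ 2 - y $ 3) / 4, 0, (1 + y $ 3) / 2,
             (2 * y $ 2 - 3 - 4 * y $ 1 - y $ 3) / 4, 1 + y $ 1, 0, 0]"],
          unfold barycentric_simps, (intro conjI refl list.pred_inject(1) | linarith)+)
    qed
  next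
    case False
    note c0 = this
    show ?thesis
    proof (cases "0 \<le> 2 + y $ 1 + 2 * y $ 2 - y $ 3")
      case True
      show ?thesis
        using y c0 True
        by - (rule in_convex_hull_real_vec[of
            "[(1 - 2 * y $ 1 - 4 * y $ 2 - 3 * y $ 3) / 10, 0, 1 + y $ 2, 0, 0,
             (y $ 3 - 1 - 2 * y $ 2) / 2, (2 + y $ 1 + 2 * y $ 2 - y $ 3) / 5]"],
          unfold barycentric_simps, (intro conjI refl list.pred_inject(1) | linarith)+)
    next
      case False
      show ?thesis
        using y c0 False
        by - (rule in_convex_hull_real_vec[of
            "[(1 - y $ 1 - 2 * y $ 2 - 2 * y $ 3) / 6, (y $ 3 - 2 - y $ 1 - 2 * y $ 2) / 3,
             1 + y $ 2, 0, 0, (1 + y $ 1) / 2, 0]"],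
          unfold barycentric_simps, (intro conjI refl list.pred_inject(1) | linarith)+)
    qed
  qed
qed (auto simp: sum_4 forall_4)

text \<open>The cut removes the vertex with y_3 = 7/2; for x^3 y + y^2 z + z^3 + w^9 it comes from
  y^2 w^3.\<close>

lemma polar_pair_3_3_2:
  "polar_pair (vector [3, 3, 2, 1] :: int ^ 4) {vector [-1, 0, -1, 0]}
    (set [vector [-1, -1, -1, 8],
      vector [-1, -1, 2, 2],
      vector [-1, 0, 2, -1],
      vector [-1, 2, -1, -1],
      vector [2, -1, -1, -1]])"
    (is "polar_pair ?k ?X (set ?ws)")
proof (rule polar_pairI)
  fix y :: "real ^ 4"
  assume "(\<Sum>i\<in>UNIV. of_int (?k $ i) * y $ i) = 0" "\<forall>i. -1 \<le> y $ i"
    "\<forall>c\<in>?X. -1 \<le> (\<Sum>i\<in>UNIV. of_int (c $ i) * y $ i)"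
  then have y: "3 * y $ 1 + 3 * y $ 2 + 2 * y $ 3 + y $ 4 = 0"
    "-1 \<le> y $ 1" "-1 \<le> y $ 2" "-1 \<le> y $ 3" "-1 \<le> y $ 4"
    "-1 \<le> - y $ 1 - y $ 3"
    by (simp_all add: sum_4 forall_4)
  show "y \<in> convex hull (real_vec ` set ?ws)"
  proof (cases "0 \<le> y $ 1 + y $ 2 + y $ 3")
    case True
    show ?thesis
      using y True
      by - (rule in_convex_hull_real_vec[of
          "[0, (1 - 3 * y $ 1 - 3 * y $ 2 - 2 * y $ 3) / 3, y $ 1 + y $ 2 + y $ 3,
           (1 - y $ 1 - y $ 3) / 3, (1 + y $ 1) / 3]"],
        unfold barycentric_simps, (intro conjI refl list.pred_inject(1) | linarith)+)
  next
    case False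
    show ?thesis
      using y False
      by - (rule in_convex_hull_real_vec[of
          "[(- y $ 1 - y $ 2 - y $ 3) / 3, (1 + y $ 3) / 3, 0, (1 + y $ 2) / 3, (1 + y $ 1) / 3]"],
        unfold barycentric_simps, (intro conjI refl list.pred_inject(1) | linarith)+)
  qed
qed (auto simp: sum_4 forall_4)

lemma polar_pair_1_3_4:
  "polar_pair (vector [1, 3, 4, 1] :: int ^ 4) {vector [0, -2, -3, 0]}
    (set [vector [-1, -1, -1, 8],
      vector [-1, -1, 1, 0],
      vector [-1, 2, -1, -1],
      vector [0, -1, 1, -1],
      vector [8, -1, -1, -1]])"
    (is "polar_pair ?k ?X (set ?ws)")
proof (rule polar_pairI)
  fix y :: "real ^ 4"
  assume "(\<Sum>i\<in>UNIV. of_int (?k $ i) * y $ i) = 0" "\<forall>i. -1 \<le> y $ i"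
    "\<forall>c\<in>?X. -1 \<le> (\<Sum>i\<in>UNIV. of_int (c $ i) * y $ i)"
  then have y: "y $ 1 + 3 * y $ 2 + 4 * y $ 3 + y $ 4 = 0"
    "-1 \<le> y $ 1" "-1 \<le> y $ 2" "-1 \<le> y $ 3" "-1 \<le> y $ 4"
    "-1 \<le> - 2 * y $ 2 - 3 * y $ 3"
    by (simp_all add: sum_4 forall_4)
  show "y \<in> convex hull (real_vec ` set ?ws)"
  proof (cases "0 \<le> 1 + 2 * y $ 1 - y $ 3")
    case True
    show ?thesis
      using y True
      by - (rule in_convex_hull_real_vec[of
          "[(1 - y $ 1 - 3 * y $ 2 - 4 * y $ 3) / 9, 0, (1 + y $ 2) / 3, (1 + y $ 3) / 2,
           (1 + 2 * y $ 1 - y $ 3) / 18]"],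
        unfold barycentric_simps, (intro conjI refl list.pred_inject(1) | linarith)+)
  next
    case False
    show ?thesis
      using y False
      by - (rule in_convex_hull_real_vec[of
          "[(1 - 2 * y $ 2 - 3 * y $ 3) / 6, (y $ 3 - 1 - 2 * y $ 1) / 2, (1 + y $ 2) / 3,
           1 + y $ 1, 0]"],
        unfold barycentric_simps, (intro conjI refl list.pred_inject(1) | linarith)+)
  qed
qed (auto simp: sum_4 forall_4)

text \<open>Only \<open>k\<close> and the coefficients of the cut enter, so the pair serves two
  polynomials: the cut comes from x^4 w^6 for x^7 + x y^3 + z^2 + y w^10 and from x^6 w^6 for x^9 y
  + y^3 + z^2 + x w^10.\<close>

lemma polar_pair_1_3_5:
  "polar_pair (vector [1, 3, 5, 1] :: int ^ 4) {vector [0, -2, -3, 0]}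
    (set [vector [-1, -1, -1, 9],
      vector [-1, -1, 1, -1],
      vector [-1, 2, -1, 0],
      vector [0, 2, -1, -1],
      vector [9, -1, -1, -1]])"
    (is "polar_pair ?k ?X (set ?ws)")
proof (rule polar_pairI)
  fix y :: "real ^ 4"
  assume "(\<Sum>i\<in>UNIV. of_int (?k $ i) * y $ i) = 0" "\<forall>i. -1 \<le> y $ i"
    "\<forall>c\<in>?X. -1 \<le> (\<Sum>i\<in>UNIV. of_int (c $ i) * y $ i)"
  then have y: "y $ 1 + 3 * y $ 2 + 5 * y $ 3 + y $ 4 = 0"
    "-1 \<le> y $ 1" "-1 \<le> y $ 2" "-1 \<le> y $ 3" "-1 \<le> y $ 4"
    "-1 \<le> - 2 * y $ 2 - 3 * y $ 3"
    by (simp_all add: sum_4 forall_4)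
  show "y \<in> convex hull (real_vec ` set ?ws)"
  proof (cases "0 \<le> 2 + 3 * y $ 1 - y $ 2")
    case True
    show ?thesis
      using y True
      by - (rule in_convex_hull_real_vec[of
          "[(1 - y $ 1 - 3 * y $ 2 - 5 * y $ 3) / 10, (1 + y $ 3) / 2, 0, (1 + y $ 2) / 3,
           (2 + 3 * y $ 1 - y $ 2) / 30]"],
        unfold barycentric_simps, (intro conjI refl list.pred_inject(1) | linarith)+)
  next
    case False
    show ?thesis
      using y False
      by - (rule in_convex_hull_real_vec[of
          "[(1 - 2 * y $ 2 - 3 * y $ 3) / 6, (1 + y $ 3) / 2, (y $ 2 - 2 - 3 * y $ 1) / 3,
           1 + y $ 1, 0]"],
        unfold barycentric_simps, (intro conjI refl list.pred_inject(1) | linarith)+)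
  qed
qed (auto simp: sum_4 forall_4)

lemma polar_pair_1_4_6:
  "polar_pair (vector [1, 4, 6, 1] :: int ^ 4) {}
    (set [vector [-1, -1, -1, 11],
      vector [-1, -1, 1, -1],
      vector [-1, 2, -1, -1],
      vector [11, -1, -1, -1]])"
    (is "polar_pair ?k ?X (set ?ws)")
proof (rule polar_pairI)
  fix y :: "real ^ 4"
  assume "(\<Sum>i\<in>UNIV. of_int (?k $ i) * y $ i) = 0" "\<forall>i. -1 \<le> y $ i"
    "\<forall>c\<in>?X. -1 \<le> (\<Sum>i\<in>UNIV. of_int (c $ i) * y $ i)"
  then have y: "y $ 1 + 4 * y $ 2 + 6 * y $ 3 + y $ 4 = 0"
    "-1 \<le> y $ 1" "-1 \<le> y $ 2" "-1 \<le> y $ 3" "-1 \<le> y $ 4"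
    by (simp_all add: sum_4 forall_4)
  show "y \<in> convex hull (real_vec ` set ?ws)"
    using y
    by - (rule in_convex_hull_real_vec[of
        "[(1 - y $ 1 - 4 * y $ 2 - 6 * y $ 3) / 12, (1 + y $ 3) / 2, (1 + y $ 2) / 3,
         (1 + y $ 1) / 12]"],
      unfold barycentric_simps, (intro conjI refl list.pred_inject(1) | linarith)+)
qed (auto simp: sum_4 forall_4)

text \<open>A single cut removes both non-integral vertices, the one with y_2 = 5/2 and the one with
  y_3 = 4/3.\<close>

lemma polar_pair_1_2_3:
  "polar_pair (vector [1, 2, 3, 1] :: int ^ 4) {vector [0, -2, -3, 0]}
    (set [vector [-1, -1, -1, 6],
      vector [-1, -1, 1, 0],
      vector [-1, 2, -1, 0],
      vector [0, -1, 1, -1],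
      vector [0, 2, -1, -1],
      vector [6, -1, -1, -1]])"
    (is "polar_pair ?k ?X (set ?ws)")
proof (rule polar_pairI)
  fix y :: "real ^ 4"
  assume "(\<Sum>i\<in>UNIV. of_int (?k $ i) * y $ i) = 0" "\<forall>i. -1 \<le> y $ i"
    "\<forall>c\<in>?X. -1 \<le> (\<Sum>i\<in>UNIV. of_int (c $ i) * y $ i)"
  then have y: "y $ 1 + 2 * y $ 2 + 3 * y $ 3 + y $ 4 = 0"
    "-1 \<le> y $ 1" "-1 \<le> y $ 2" "-1 \<le> y $ 3" "-1 \<le> y $ 4"
    "-1 \<le> - 2 * y $ 2 - 3 * y $ 3"
    by (simp_all add: sum_4 forall_4)
  show "y \<in> convex hull (real_vec ` set ?ws)"
  proof (cases "0 \<le> 1 + 2 * y $ 1 - y $ 3")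
    case True
    note c0 = this
    show ?thesis
    proof (cases "0 \<le> 1 + 6 * y $ 1 - 2 * y $ 2 - 3 * y $ 3")
      case True
      show ?thesis
        using y c0 True
        by - (rule in_convex_hull_real_vec[of
            "[(1 - y $ 1 - 2 * y $ 2 - 3 * y $ 3) / 7, 0, 0, (1 + y $ 3) / 2, (1 + y $ 2) / 3,
             (1 + 6 * y $ 1 - 2 * y $ 2 - 3 * y $ 3) / 42]"],
          unfold barycentric_simps, (intro conjI refl list.pred_inject(1) | linarith)+)
    next
      case False
      show ?thesis
        using y c0 False
        by - (rule in_convex_hull_real_vec[of
            "[(1 - 2 * y $ 2 - 3 * y $ 3) / 6, 0, (2 * y $ 2 + 3 * y $ 3 - 1 - 6 * y $ 1) / 6,
             (1 + y $ 3) / 2, (1 + 2 * y $ 1 - y $ 3) / 2, 0]"],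
          unfold barycentric_simps, (intro conjI refl list.pred_inject(1) | linarith)+)
    qed
  next
    case False
    show ?thesis
      using y False
      by - (rule in_convex_hull_real_vec[of
          "[(1 - 2 * y $ 2 - 3 * y $ 3) / 6, (y $ 3 - 1 - 2 * y $ 1) / 2, (1 + y $ 2) / 3,
           1 + y $ 1, 0, 0]"],
        unfold barycentric_simps, (intro conjI refl list.pred_inject(1) | linarith)+)
  qed
qed (auto simp: sum_4 forall_4)

text \<open>In x^8 z + y^3 + z^2 + x w^9 the monomial x^8 z is the midpoint of x^16 and z^2; adding
  x^16 gives a simplex.\<close>

lemma polar_pair_1_3_4_simplex:
  "polar_pair (vector [1, 3, 4, 1] :: int ^ 4) {vector [2, 0, -1, 0]}
    (set [vector [-1, -1, -1, 8],
      vector [-1, 2, -1, -1],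
      vector [0, -1, 1, -1],
      vector [8, -1, -1, -1]])"
    (is "polar_pair ?k ?X (set ?ws)")
proof (rule polar_pairI)
  fix y :: "real ^ 4"
  assume "(\<Sum>i\<in>UNIV. of_int (?k $ i) * y $ i) = 0" "\<forall>i. -1 \<le> y $ i"
    "\<forall>c\<in>?X. -1 \<le> (\<Sum>i\<in>UNIV. of_int (c $ i) * y $ i)"
  then have y: "y $ 1 + 3 * y $ 2 + 4 * y $ 3 + y $ 4 = 0"
    "-1 \<le> y $ 1" "-1 \<le> y $ 2" "-1 \<le> y $ 3" "-1 \<le> y $ 4"
    "-1 \<le> 2 * y $ 1 - y $ 3"
    by (simp_all add: sum_4 forall_4)
  show "y \<in> convex hull (real_vec ` set ?ws)"
    using y
    by - (rule in_convex_hull_real_vec[of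
        "[(1 - y $ 1 - 3 * y $ 2 - 4 * y $ 3) / 9, (1 + y $ 2) / 3, (1 + y $ 3) / 2,
         (1 + 2 * y $ 1 - y $ 3) / 18]"],
      unfold barycentric_simps, (intro conjI refl list.pred_inject(1) | linarith)+)
qed (auto simp: sum_4 forall_4)

lemma polar_pair_1_4_2:
  "polar_pair (vector [1, 4, 2, 1] :: int ^ 4) {}
    (set [vector [-1, -1, -1, 7],
      vector [-1, -1, 3, -1],
      vector [-1, 1, -1, -1],
      vector [7, -1, -1, -1]])"
    (is "polar_pair ?k ?X (set ?ws)")
proof (rule polar_pairI)
  fix y :: "real ^ 4"
  assume "(\<Sum>i\<in>UNIV. of_int (?k $ i) * y $ i) = 0" "\<forall>i. -1 \<le> y $ i"
    "\<forall>c\<in>?X. -1 \<le> (\<Sum>i\<in>UNIV. of_int (c $ i) * y $ i)"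
  then have y: "y $ 1 + 4 * y $ 2 + 2 * y $ 3 + y $ 4 = 0"
    "-1 \<le> y $ 1" "-1 \<le> y $ 2" "-1 \<le> y $ 3" "-1 \<le> y $ 4"
    by (simp_all add: sum_4 forall_4)
  show "y \<in> convex hull (real_vec ` set ?ws)"
    using y
    by - (rule in_convex_hull_real_vec[of
        "[(1 - y $ 1 - 4 * y $ 2 - 2 * y $ 3) / 8, (1 + y $ 3) / 4, (1 + y $ 2) / 2,
         (1 + y $ 1) / 8]"],
      unfold barycentric_simps, (intro conjI refl list.pred_inject(1) | linarith)+)
qed (auto simp: sum_4 forall_4)

text \<open>The cuts remove the vertices with y_3 = 5/2 and y_2 = 4/3 respectively; for x^6 y + y^2
  z + z^2 + x w^7 they come from x^3 y w^3 and x^4 w^4.\<close>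

lemma polar_pair_1_3_2:
  "polar_pair (vector [1, 3, 2, 1] :: int ^ 4) {vector [0, -1, -1, 0], vector [0, -2, -1, 0]}
    (set [vector [-1, -1, -1, 6],
      vector [-1, -1, 2, 0],
      vector [-1, 0, 1, -1],
      vector [-1, 1, -1, 0],
      vector [0, -1, 2, -1],
      vector [0, 1, -1, -1],
      vector [6, -1, -1, -1]])"
    (is "polar_pair ?k ?X (set ?ws)")
proof (rule polar_pairI)
  fix y :: "real ^ 4"
  assume "(\<Sum>i\<in>UNIV. of_int (?k $ i) * y $ i) = 0" "\<forall>i. -1 \<le> y $ i"
    "\<forall>c\<in>?X. -1 \<le> (\<Sum>i\<in>UNIV. of_int (c $ i) * y $ i)"
  then have y: "y $ 1 + 3 * y $ 2 + 2 * y $ 3 + y $ 4 = 0"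
    "-1 \<le> y $ 1" "-1 \<le> y $ 2" "-1 \<le> y $ 3" "-1 \<le> y $ 4"
    "-1 \<le> - y $ 2 - y $ 3" "-1 \<le> - 2 * y $ 2 - y $ 3"
    by (simp_all add: sum_4 forall_4)
  show "y \<in> convex hull (real_vec ` set ?ws)"
  proof (cases "0 \<le> 1 + 2 * y $ 2 - y $ 3")
    case True
    note c0 = this
    show ?thesis
    proof (cases "0 \<le> 3 + 4 * y $ 1 + y $ 3 - 2 * y $ 2")
      case True
      show ?thesis
        using y c0 True
        by - (rule in_convex_hull_real_vec[of
            "[(1 - y $ 1 - 3 * y $ 2 - 2 * y $ 3) / 7, 0, (1 + y $ 3) / 2, 0, 0,
             (1 + 2 * y $ 2 - y $ 3) / 4, (3 + 4 * y $ 1 + y $ 3 - 2 * y $ 2) / 28]"],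
          unfold barycentric_simps, (intro conjI refl list.pred_inject(1) | linarith)+)
    next
      case False
      show ?thesis
        using y c0 False
        by - (rule in_convex_hull_real_vec[of
            "[(1 - 2 * y $ 2 - y $ 3) / 4, 0, (1 + y $ 3) / 2,
             (2 * y $ 2 - 3 - 4 * y $ 1 - y $ 3) / 4, 0, 1 + y $ 1, 0]"],
          unfold barycentric_simps, (intro conjI refl list.pred_inject(1) | linarith)+)
    qed
  next
    case False
    note c0 = this
    show ?thesis
    proof (cases "0 \<le> 4 + 3 * y $ 1 + 2 * y $ 2 - y $ 3")
      case True
      show ?thesis
        using y c0 True
        by - (rule in_convex_hull_real_vec[of
            "[(1 - y $ 1 - 3 * y $ 2 - 2 * y $ 3) / 7, 0, 1 + y $ 2, 0,
             (y $ 3 - 1 - 2 * y $ 2) / 3, 0, (4 + 3 * y $ 1 + 2 * y $ 2 - y $ 3) / 21]"],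
          unfold barycentric_simps, (intro conjI refl list.pred_inject(1) | linarith)+)
    next
      case False
      show ?thesis
        using y c0 False
        by - (rule in_convex_hull_real_vec[of
            "[(1 - y $ 2 - y $ 3) / 3, (y $ 3 - 4 - 3 * y $ 1 - 2 * y $ 2) / 3, 1 + y $ 2, 0,
             1 + y $ 1, 0, 0]"],
          unfold barycentric_simps, (intro conjI refl list.pred_inject(1) | linarith)+)
    qed
  qed
qed (auto simp: sum_4 forall_4)

lemma polar_pair_1_2_2:
  "polar_pair (vector [1, 2, 2, 1] :: int ^ 4) {}
    (set [vector [-1, -1, -1, 5],
      vector [-1, -1, 2, -1],
      vector [-1, 2, -1, -1],
      vector [5, -1, -1, -1]])"
    (is "polar_pair ?k ?X (set ?ws)")
proof (rule polar_pairI)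
  fix y :: "real ^ 4"
  assume "(\<Sum>i\<in>UNIV. of_int (?k $ i) * y $ i) = 0" "\<forall>i. -1 \<le> y $ i"
    "\<forall>c\<in>?X. -1 \<le> (\<Sum>i\<in>UNIV. of_int (c $ i) * y $ i)"
  then have y: "y $ 1 + 2 * y $ 2 + 2 * y $ 3 + y $ 4 = 0"
    "-1 \<le> y $ 1" "-1 \<le> y $ 2" "-1 \<le> y $ 3" "-1 \<le> y $ 4"
    by (simp_all add: sum_4 forall_4)
  show "y \<in> convex hull (real_vec ` set ?ws)"
    using y
    by - (rule in_convex_hull_real_vec[of
        "[(1 - y $ 1 - 2 * y $ 2 - 2 * y $ 3) / 6, (1 + y $ 3) / 3, (1 + y $ 2) / 3,
         (1 + y $ 1) / 6]"],
      unfold barycentric_simps, (intro conjI refl list.pred_inject(1) | linarith)+)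
qed (auto simp: sum_4 forall_4)

section \<open>Verification for the sixteen matrices\<close>

text \<open>The matrix is block triangular, so invertibility reduces to a trivial kernel of the
  upper left 3 by 3 block together with a_44 > 0.\<close>

lemma weighted_matrixI:
  fixes k1 k2 k3 :: int and a11 :: nat
  assumes "k1 * int a11 + k2 * int a21 + k3 * int a31 + int a41 = int a44"
    and "k1 * int a12 + k2 * int a22 + k3 * int a32 + int a42 = int a44"
    and "k1 * int a13 + k2 * int a23 + k3 * int a33 + int a43 = int a44"
    and "k1 + k2 + k3 + 1 = int a44" and "a44 > 0"
    and kernel: "\<And>x y z :: real. real a11 * x + real a12 * y + real a13 * z = 0 \<Longrightarrow>
      real a21 * x + real a22 * y + real a23 * z = 0 \<Longrightarrow>
      real a31 * x + real a32 * y + real a33 * z = 0 \<Longrightarrow> x = 0 \<and> y = 0 \<and> z = 0"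
  shows "weighted_matrix (vector (map vector [[a11, a12, a13, 0], [a21, a22, a23, 0], [a31, a32, a33, 0],
    [a41, a42, a43, a44]])) (vector [k1, k2, k3, 1])" (is "weighted_matrix ?A _")
proof
  have "x = 0" if "real_mat ?A *v x = 0" for x
  proof -
    have "x $ 1 = 0 \<and> x $ 2 = 0 \<and> x $ 3 = 0"
      using that by (intro kernel) (simp_all add: vec_eq_iff matrix_vector_mult_def sum_4 forall_4)
    then show ?thesis
      using that \<open>a44 > 0\<close> by (simp add: vec_eq_iff matrix_vector_mult_def sum_4 forall_4)
  qed
  then show "invertible (real_mat ?A)"
    by (simp add: invertible_left_inverse matrix_left_invertible_ker)
  show "?A $ i $ 4 = 0" if "i \<noteq> 4" for i
    using exhaust_4[of i] that by auto
  show "(\<Sum>i\<in>UNIV. vector [k1, k2, k3, 1] $ i * int (?A $ i $ j)) = int (?A $ 4 $ 4)" for j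
    using exhaust_4[of j] assms by (auto simp: sum_4)
qed (use assms in \<open>simp_all add: sum_4\<close>)

lemma sixteen_matrices_polar_pairs:
  assumes "A \<in> set sixteen_matrices"
  shows "\<exists>k X W. weighted_matrix A k \<and> polar_pair k X W \<and>
    (\<forall>c\<in>X. \<forall>j. (\<Sum>i\<in>UNIV. c $ i * (int (A $ i $ j) - 1)) \<ge> -1)"
proof -
  \<comment> \<open>The premises are ordered so that a polar pair fixes \<open>k\<close>,
    \<open>X\<close> and \<open>W\<close>, and each matrix leaves only numerical conditions.\<close>
  have certificate: "\<exists>k X W. weighted_matrix A k \<and> polar_pair k X W \<and>
      (\<forall>c\<in>X. \<forall>j. (\<Sum>i\<in>UNIV. c $ i * (int (A $ i $ j) - 1)) \<ge> -1)"
    if "A = vector (map vector rows)" "weighted_matrix (vector (map vector rows)) k" "polar_pair k X W"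
      "\<forall>c\<in>X. \<forall>j. (\<Sum>i\<in>UNIV. c $ i * (int ((vector (map vector rows) :: nat ^ 4 ^ 4) $ i $ j) - 1)) \<ge> -1"
    for rows k X W
    using that by blast
  show ?thesis
    using assms unfolding sixteen_matrices_def list.map list.set insert_iff empty_iff
    apply (elim disjE)
    subgoal by (erule certificate[OF _ weighted_matrixI polar_pair_2_6_9, unfolded list.map])
      (simp_all add: sum_4 forall_4)
    subgoal by (erule certificate[OF _ weighted_matrixI polar_pair_2_4_7, unfolded list.map])
      (simp_all add: sum_4 forall_4)
    subgoal by (erule certificate[OF _ weighted_matrixI polar_pair_2_4_5, unfolded list.map])
      (simp_all add: sum_4 forall_4)
    subgoal by (erule certificate[OF _ weighted_matrixI polar_pair_2_6_3, unfolded list.map])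
      (simp_all add: sum_4 forall_4)
    subgoal by (erule certificate[OF _ weighted_matrixI polar_pair_2_4_3, unfolded list.map])
      (simp_all add: sum_4 forall_4)
    subgoal by (erule certificate[OF _ weighted_matrixI polar_pair_3_3_2, unfolded list.map])
      (simp_all add: sum_4 forall_4)
    subgoal by (erule certificate[OF _ weighted_matrixI polar_pair_1_3_4, unfolded list.map])
      (simp_all add: sum_4 forall_4)
    subgoal by (erule certificate[OF _ weighted_matrixI polar_pair_1_3_5, unfolded list.map])
      (simp_all add: sum_4 forall_4)
    subgoal by (erule certificate[OF _ weighted_matrixI polar_pair_1_4_6, unfolded list.map])
      (simp_all add: sum_4 forall_4)
    subgoal by (erule certificate[OF _ weighted_matrixI polar_pair_1_2_3, unfolded list.map])
      (simp_all add: sum_4 forall_4)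
    subgoal by (erule certificate[OF _ weighted_matrixI polar_pair_1_3_5, unfolded list.map])
      (simp_all add: sum_4 forall_4)
    subgoal by (erule certificate[OF _ weighted_matrixI polar_pair_1_2_3, unfolded list.map])
      (simp_all add: sum_4 forall_4)
    subgoal by (erule certificate[OF _ weighted_matrixI polar_pair_1_3_4_simplex, unfolded list.map])
      (simp_all add: sum_4 forall_4)
    subgoal by (erule certificate[OF _ weighted_matrixI polar_pair_1_4_2, unfolded list.map])
      (simp_all add: sum_4 forall_4)
    subgoal by (erule certificate[OF _ weighted_matrixI polar_pair_1_3_2, unfolded list.map])
      (simp_all add: sum_4 forall_4)
    subgoal by (erule certificate[OF _ weighted_matrixI polar_pair_1_2_2, unfolded list.map])
      (simp_all add: sum_4 forall_4)
    by simp
qed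

theorem theorem1p1:
  fixes A :: "nat ^ 4 ^ 4"
    and F F' :: "complex ^ 4 \<Rightarrow> complex"
    and f :: "complex ^ 3 \<Rightarrow> complex"
    and q q' :: "nat ^ 4" and h h' :: nat
    and G G' :: "(complex ^ 4) set"
    and M M' :: "(int ^ 4) set"
    and N :: "(int ^ 4 \<Rightarrow> int) set"
  assumes "A \<in> set sixteen_matrices"
    and "F = matrix_poly A" and "F' = matrix_poly (transpose A)"
    and "f = (\<lambda>u. F (vector [u $ 1, u $ 2, u $ 3, 0]))"
    and "weight_system F q h" and "weight_system F' q' h'"
    and "G = SL4_lift (G_max f)" and "G' = transpose_group A G"
    and "M = character_lattice q G" and "M' = character_lattice q' G'"
    and "N = dual_lattice M"
  shows "\<exists>\<phi> \<Phi> \<Delta>.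
      \<phi> \<in> iso (additive_group N) (additive_group M') \<and>
      linear \<Phi> \<and> (\<forall>n \<in> N. \<Phi> (real_ext M n) = real_vec (\<phi> n)) \<and>
      reflexive_polytope M \<Delta> \<and>
      newton_polytope A \<subseteq> \<Delta> \<and>
      newton_polytope (transpose A) \<subseteq> \<Phi> ` polar_dual M \<Delta>"
proof -
  obtain k X W where "weighted_matrix A k" and "polar_pair k X W"
    and "\<And>c j. c \<in> X \<Longrightarrow> (\<Sum>i\<in>UNIV. c $ i * (int (A $ i $ j) - 1)) \<ge> -1"
    using sixteen_matrices_polar_pairs[OF assms(1)] by blast
  then show ?thesis
    unfolding \<open>N = dual_lattice M\<close>
    using assms by (intro weighted_matrix.mirror_duality) simp_all
qed

end
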